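(* Let $G$ be a Hausdorff locally compact group, let $K$ be a compact subgroup of $\mathrm{Mor}(G)$ with Haar measure $dk$, and let $\mu$ be a complex measure on $G$ with compact support which is $K$-invariant. Let $\delta>0$. If a continuous function $f:G\to\mathbb{C}$ satisfies the inequality $$\Bigl|\int_{G}\int_{K}f\bigl(x\,t\,(k\cdot y)\bigr)\,dk\,d\mu(t)-f(x)f(y)\Bigr|\leq\delta\qquad\text{for all }x,y\in G,$$ then either $$|f(x)|\leq\frac{\|\mu\|+\sqrt{\|\mu\|^{2}+4\delta}}{2}\qquad\text{for all }x\in G,$$ or $$\int_{G}\int_{K}f\bigl(x\,t\,(k\cdot y)\bigr)\,dk\,d\mu(t)=f(x)f(y)\qquad\text{for all }x,y\in G.$$
   Context: $G$ is not assumed abelian. $\mathrm{Mor}(G)$ is the group (under composition) of all maps $k:G\to G$ that are homeomorphisms of $G$ onto itself and are either group automorphisms or group antiautomorphisms ($k(xy)=k(y)k(x)$). The action of $k\in K$ on $x\in G$ is written $k\cdot x$. The compact group $K$ acts continuously on $G$ (the map $K\times G\to G$, $(k,x)\mapsto k\cdot x$, is continuous), and $dk$ is the normalized Haar measure on $K$ (total mass $1$). A complex measure means a bounded complex (regular Borel) measure on $G$; $\|\mu\|$ denotes its total variation norm. The measure $\mu$ is $K$-invariant if $\int_G f(k\cdot t)\,d\mu(t)=\int_G f(t)\,d\mu(t)$ for all $k\in K$ and all continuous $f:G\to\mathbb{C}$. *)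

theory Defs
  imports "HOL-Analysis.Analysis" "HOL-Algebra.Coset"
begin

text \<open>
  The group \<open>G\<close> is a type of class \<^class>\<open>topological_group_add\<close>. That class writes the group
  operation as \<open>+\<close> but does not assume it to be commutative, so \<open>x + t + y\<close> stands for the product
  \<open>xty\<close>, in this order.
\<close>

section \<open>Automorphisms and antiautomorphisms\<close>

definition Mor :: "('a::topological_group_add \<Rightarrow> 'a) monoid" where
  "Mor = \<lparr>carrier = {k. homeomorphic_map euclidean euclidean k \<and>
                        ((\<forall>x y. k (x + y) = k x + k y) \<or> (\<forall>x y. k (x + y) = k y + k x))},
          mult = (\<circ>), one = id\<rparr>"

section \<open>Compact groups and their Haar measure\<close>

definition borel_sets_of :: "'a topology \<Rightarrow> 'a set set" where
  "borel_sets_of T = sigma_sets (topspace T) {U. openin T U}"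

definition regular_on :: "'a topology \<Rightarrow> ('a set \<Rightarrow> ennreal) \<Rightarrow> bool" where
  "regular_on T \<phi> \<longleftrightarrow>
     (\<forall>A \<in> borel_sets_of T.
        \<phi> A = (INF U \<in> {U. openin T U \<and> A \<subseteq> U}. \<phi> U) \<and>
        \<phi> A = (SUP C \<in> {C. compactin T C \<and> C \<subseteq> A}. \<phi> C))"

definition compact_group :: "('k, 'm) monoid_scheme \<Rightarrow> 'k topology \<Rightarrow> bool" where
  "compact_group H T \<longleftrightarrow>
     group H \<and> topspace T = carrier H \<and> compact_space T \<and> Hausdorff_space T \<and>
     continuous_map (prod_topology T T) T (\<lambda>(g, h). g \<otimes>\<^bsub>H\<^esub> h) \<and>
     continuous_map T T (\<lambda>h. inv\<^bsub>H\<^esub> h)"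

definition normalized_haar_measure ::
    "('k, 'm) monoid_scheme \<Rightarrow> 'k topology \<Rightarrow> 'k measure \<Rightarrow> bool" where
  "normalized_haar_measure H T dk \<longleftrightarrow>
     space dk = topspace T \<and> sets dk = borel_sets_of T \<and>
     regular_on T (emeasure dk) \<and> emeasure dk (topspace T) = 1 \<and>
     (\<forall>g \<in> carrier H. \<forall>A \<in> sets dk. emeasure dk (g <#\<^bsub>H\<^esub> A) = emeasure dk A)"

section \<open>Complex measures\<close>

text \<open>
  A complex measure is a countably additive function on the Borel sets; its values on other sets are
  irrelevant. The series below converges absolutely, since the assumption covers every reordering
  of the sets; taking all sets empty yields \<open>\<mu> {} = 0\<close>.
\<close>

definition countably_additive_borel :: "('a::topological_space set \<Rightarrow> complex) \<Rightarrow> bool" where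
  "countably_additive_borel \<mu> \<longleftrightarrow>
     (\<forall>A :: nat \<Rightarrow> 'a set. range A \<subseteq> sets borel \<longrightarrow> disjoint_family A \<longrightarrow>
        (\<lambda>n. \<mu> (A n)) sums \<mu> (\<Union>n. A n))"

definition total_variation :: "('a::topological_space set \<Rightarrow> complex) \<Rightarrow> 'a set \<Rightarrow> ennreal" where
  "total_variation \<mu> A =
     (SUP E \<in> {E :: nat \<Rightarrow> 'a set. range E \<subseteq> sets borel \<and> disjoint_family E \<and> (\<Union>n. E n) = A}.
        \<Sum>n. ennreal (cmod (\<mu> (E n))))"

definition complex_measure :: "('a::topological_space set \<Rightarrow> complex) \<Rightarrow> bool" where
  "complex_measure \<mu> \<longleftrightarrow>
     countably_additive_borel \<mu> \<and> total_variation \<mu> UNIV < \<infinity> \<and>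
     regular_on euclidean (total_variation \<mu>)"

definition measure_norm :: "('a::topological_space set \<Rightarrow> complex) \<Rightarrow> real" where
  "measure_norm \<mu> = enn2real (total_variation \<mu> UNIV)"

definition measure_support :: "('a::topological_space set \<Rightarrow> complex) \<Rightarrow> 'a set" where
  "measure_support \<mu> = {x. \<forall>U. open U \<longrightarrow> x \<in> U \<longrightarrow> total_variation \<mu> U \<noteq> 0}"

text \<open>
  The positive part in the Jordan decomposition of a real measure \<open>\<nu>\<close>; the negative part is the
  positive part of \<open>-\<nu>\<close>. The function \<^const>\<open>ennreal\<close> sends negative numbers to \<open>0\<close>, which does
  not affect the supremum because \<open>B = {}\<close> is admitted.
\<close>

definition positive_part :: "('a::topological_space set \<Rightarrow> real) \<Rightarrow> 'a measure" where
  "positive_part \<nu> =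
     measure_of UNIV (sets borel) (\<lambda>A. SUP B \<in> {B \<in> sets borel. B \<subseteq> A}. ennreal (\<nu> B))"

definition signed_integral ::
    "('a::topological_space set \<Rightarrow> real) \<Rightarrow> ('a \<Rightarrow> complex) \<Rightarrow> complex" where
  "signed_integral \<nu> f =
     (LINT t|positive_part \<nu>. f t) - (LINT t|positive_part (\<lambda>A. - \<nu> A). f t)"

definition complex_integral ::
    "('a::topological_space set \<Rightarrow> complex) \<Rightarrow> ('a \<Rightarrow> complex) \<Rightarrow> complex" where
  "complex_integral \<mu> f =
     signed_integral (\<lambda>A. Re (\<mu> A)) f + \<i> * signed_integral (\<lambda>A. Im (\<mu> A)) f"

definition invariant_under ::
    "('a::topological_space \<Rightarrow> 'a) set \<Rightarrow> ('a set \<Rightarrow> complex) \<Rightarrow> bool" where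
  "invariant_under K \<mu> \<longleftrightarrow>
     (\<forall>k \<in> K. \<forall>f :: 'a \<Rightarrow> complex. continuous_on UNIV f \<longrightarrow>
        complex_integral \<mu> (\<lambda>t. f (k t)) = complex_integral \<mu> f)"

end

theory Submission
  imports Defs
begin

text \<open>
  Write \<open>A(x,y)\<close> for the double integral of \<open>f(x t (k\<cdot>y))\<close> over \<open>k \<in> K\<close> and \<open>t \<in> G\<close>, so that
  \<open>A(x,y)\<close> is within \<open>\<delta>\<close> of \<open>f(x) f(y)\<close>.

  If \<open>f\<close> is bounded with supremum \<open>M\<close> of \<open>|f|\<close>, then \<open>|f(x)|\<^sup>2 \<le> \<delta> + |A(x,x)| \<le> \<delta> + \<parallel>\<mu>\<parallel> M\<close>, hence
  \<open>M\<^sup>2 \<le> \<delta> + \<parallel>\<mu>\<parallel> M\<close>, and solving the quadratic inequality gives the first alternative.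

  If \<open>f\<close> is unbounded, the second alternative holds. It suffices to bound
  \<open>(A(x,y) - f(x) f(y)) f(z)\<close> independently of \<open>z\<close>, for fixed \<open>x\<close> and \<open>y\<close>. The iterated average
  \<open>N(x,y,z)\<close>, the double integral of \<open>A(x t (k\<cdot>y), z)\<close>, is at a bounded distance from
  \<open>A(x,y) f(z)\<close>, and therefore at distance \<open>O(1) + \<delta> |f(z)|\<close> from \<open>f(x) f(y) f(z)\<close>. In
  \<open>N(z,y,x)\<close>, \<open>N(x,z,y)\<close> and \<open>N(z,x,y)\<close> the last argument is \<open>x\<close> or \<open>y\<close>, so these three stay at a
  bounded distance from \<open>f(x) f(y) f(z)\<close> as \<open>z\<close> varies. Hence everything follows from
  \<open>N(x,y,z) = N(z,y,x) - N(x,z,y) + N(z,x,y) + O(1)\<close> (lemma \<open>total_average_relation\<close>).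

  For this relation, split \<open>K\<close> into its automorphisms \<open>K\<^sup>+\<close> and the other elements \<open>K\<^sup>-\<close>, all of them
  antiautomorphisms, and correspondingly \<open>A = A\<^sup>+ + A\<^sup>-\<close> and \<open>N\<close> into four parts. An unbounded \<open>f\<close> is
  \<open>K\<close>-invariant: right invariance of \<open>dk\<close> gives \<open>A(x, m\<cdot>y) = A(x,y)\<close>, so that
  \<open>|f(x)| |f(m\<cdot>y) - f(y)| \<le> 2 \<delta>\<close> for all \<open>x\<close>. Reversing products by an antiautomorphism then shows
  that \<open>A\<^sup>-\<close> is symmetric; since \<open>A(x,y)\<close> and \<open>A(y,x)\<close> differ by at most \<open>2 \<delta>\<close>, so do
  \<open>A\<^sup>+(x,y)\<close> and \<open>A\<^sup>+(y,x)\<close>. In each of the four parts this moves \<open>z\<close> to the front, where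
  \<open>h\<cdot>(x t (k\<cdot>y))\<close> is a product that can be expanded, with or without reversal
  (\<open>average_distrib_True\<close>, \<open>average_distrib_False\<close>). The parts of \<open>N(x,y,z)\<close> thereby become
  parts of \<open>N\<close> at permuted arguments, and the terms match.

  The expansions need iterated integrals to be interchanged. Without second
  countability a continuous function on a product need not be measurable for the product
  \<open>\<sigma>\<close>-algebra. The integrals are therefore treated as linear functionals on continuous functions
  that are bounded by a supremum over a compact set; for these, interchange follows from uniform
  approximation by finite sums of products (\<open>carried_Fubini\<close>).
\<close>

section \<open>Functionals carried by a compact set\<close>

lemma continuous_map_dist_iff:
  fixes g :: "'b \<Rightarrow> 'c::metric_space"
  shows "continuous_map X euclidean g \<longleftrightarrow>
    (\<forall>x\<in>topspace X. \<forall>e>0. \<exists>U. openin X U \<and> x \<in> U \<and> (\<forall>y\<in>U. dist (g y) (g x) < e))"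
  using Met_TC.continuous_map_to_metric[of X g] by (simp add: dist_commute)

lemma continuous_map_comp2:
  assumes "continuous_map X Y u" "continuous_map X Z v"
    and "continuous_map (prod_topology Y Z) W (case_prod F)"
  shows "continuous_map X W (\<lambda>p. F (u p) (v p))"
  using continuous_map_compose[OF continuous_map_pairedI[OF assms(1,2)] assms(3)]
  by (simp add: o_def)

lemma continuous_map_section:
  assumes "continuous_map (prod_topology X Y) Z (case_prod F)" "x \<in> topspace X"
  shows "continuous_map Y Z (F x)"
  using continuous_map_comp2[OF _ _ assms(1), of Y "\<lambda>_. x" "\<lambda>y. y"] assms(2) by simp

lemma continuous_map_swap_args:
  assumes "continuous_map (prod_topology X Y) Z (case_prod F)"
  shows "continuous_map (prod_topology Y X) Z (\<lambda>(y, x). F x y)"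
  using continuous_map_comp2[OF continuous_map_snd continuous_map_fst assms]
  by (simp add: case_prod_beta')

lemma continuous_map_mult_complex:
  fixes g h :: "'b \<Rightarrow> complex"
  assumes "continuous_map X euclidean g" "continuous_map X euclidean h"
  shows "continuous_map X euclidean (\<lambda>x. g x * h x)"
  using assms unfolding continuous_map_atin limitin_canonical_iff by (auto intro!: tendsto_mult)

lemma continuous_map_diff_norm:
  fixes g h :: "'b \<Rightarrow> complex"
  assumes "continuous_map X euclidean g" "continuous_map X euclidean h"
  shows "continuous_map X euclideanreal (\<lambda>x. norm (g x - h x))"
  using assms unfolding continuous_map_atin limitin_canonical_iff by (auto intro!: tendsto_intros)

lemma continuous_map_of_real:
  fixes g :: "'b \<Rightarrow> real"
  assumes "continuous_map X euclidean g"
  shows "continuous_map X euclidean (\<lambda>x. complex_of_real (g x))"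
  using assms unfolding continuous_map_atin limitin_canonical_iff by (auto intro!: tendsto_intros)

lemma le_small_multiples_imp_zero:
  fixes n k :: real
  assumes "0 \<le> n" "0 \<le> k" "\<And>e. e > 0 \<Longrightarrow> n \<le> k * e"
  shows "n = 0"
proof (rule ccontr)
  assume "n \<noteq> 0"
  then have "n > 0" using assms(1) by simp
  moreover from this have "n \<le> k * (n / (k + 1))" using assms by (intro assms(3)) auto
  ultimately show False using assms(2) by (simp add: field_simps)
qed

text \<open>
  The tube lemma, applied to the open set of points where \<open>F\<close> is close to its value over \<open>x\<close>.
\<close>

lemma uniform_tube:
  fixes F :: "'x \<Rightarrow> 'y \<Rightarrow> complex"
  assumes F: "continuous_map (prod_topology X Y) euclidean (case_prod F)"
    and S: "compactin Y S" and x: "x \<in> topspace X" and e: "e > 0"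
  obtains U where "openin X U" "x \<in> U" "\<And>x' y. x' \<in> U \<Longrightarrow> y \<in> S \<Longrightarrow> norm (F x' y - F x y) < e"
proof -
  define W where "W = {p \<in> topspace (prod_topology X Y). norm (case_prod F p - F x (snd p)) \<in> {..<e}}"
  have c: "continuous_map (prod_topology X Y) euclidean (\<lambda>p. F x (snd p))"
    using continuous_map_compose[OF continuous_map_snd continuous_map_section[OF F x]]
    by (simp add: o_def)
  have W: "openin (prod_topology X Y) W"
    unfolding W_def
    by (rule openin_continuous_map_preimage[OF continuous_map_diff_norm[OF F c]]) simp
  have "{x} \<times> S \<subseteq> W"
    using compactin_subset_topspace[OF S] x e by (auto simp: W_def)
  from tube_lemma_right[OF W S x this] obtain U V where
    "openin X U" "openin Y V" "x \<in> U" "S \<subseteq> V" "U \<times> V \<subseteq> W" by blast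
  then show thesis
    by (intro that[of U]) (auto simp: W_def subset_iff)
qed

text \<open>
  The hypotheses used about integration: linearity on continuous functions, and a bound by the
  supremum over a compact set \<open>S\<close>. The constant \<open>c\<close> bounds the norm of the functional, and the
  bound makes it blind to values outside \<open>S\<close>, so that unbounded continuous functions are harmless.
\<close>

definition carried_functional ::
    "'b topology \<Rightarrow> 'b set \<Rightarrow> real \<Rightarrow> (('b \<Rightarrow> complex) \<Rightarrow> complex) \<Rightarrow> bool" where
  "carried_functional X S c J \<longleftrightarrow> compactin X S \<and> 0 \<le> c \<and>
     (\<forall>g h. continuous_map X euclidean g \<longrightarrow> continuous_map X euclidean h \<longrightarrow>
        J (\<lambda>x. g x + h x) = J g + J h) \<and>
     (\<forall>a g. continuous_map X euclidean g \<longrightarrow> J (\<lambda>x. a * g x) = a * J g) \<and>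
     (\<forall>g B. continuous_map X euclidean g \<longrightarrow> 0 \<le> B \<longrightarrow> (\<forall>x\<in>S. norm (g x) \<le> B) \<longrightarrow> norm (J g) \<le> c * B)"

context
  fixes X :: "'b topology" and S c J
  assumes J: "carried_functional X S c J"
begin

lemma carried_compact: "compactin X S"
  and carried_nonneg: "0 \<le> c"
  and carried_add: "continuous_map X euclidean g \<Longrightarrow> continuous_map X euclidean h \<Longrightarrow>
        J (\<lambda>x. g x + h x) = J g + J h"
  and carried_mult: "continuous_map X euclidean g \<Longrightarrow> J (\<lambda>x. a * g x) = a * J g"
  and carried_bound: "continuous_map X euclidean g \<Longrightarrow> 0 \<le> B \<Longrightarrow> (\<And>x. x \<in> S \<Longrightarrow> norm (g x) \<le> B) \<Longrightarrow> norm (J g) \<le> c * B"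
  using J unfolding carried_functional_def by blast+

lemma carried_diff:
  assumes "continuous_map X euclidean g" "continuous_map X euclidean h"
  shows "J (\<lambda>x. g x - h x) = J g - J h"
proof -
  have "continuous_map X euclidean (\<lambda>x. (-1) * h x)"
    by (intro continuous_map_mult_complex assms) simp
  from carried_add[OF assms(1) this] carried_mult[OF assms(2), of "-1"] show ?thesis by simp
qed

lemma carried_diff_bound:
  assumes "continuous_map X euclidean g" "continuous_map X euclidean h" "0 \<le> B"
    and "\<And>x. x \<in> S \<Longrightarrow> norm (g x - h x) \<le> B"
  shows "norm (J g - J h) \<le> c * B"
  unfolding carried_diff[OF assms(1,2), symmetric]
  by (rule carried_bound) (auto intro!: continuous_map_diff assms)

lemma carried_cong:
  assumes "continuous_map X euclidean g" "continuous_map X euclidean h"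
    and "\<And>x. x \<in> S \<Longrightarrow> g x = h x"
  shows "J g = J h"
  using carried_diff_bound[OF assms(1,2), of 0] assms(3) by simp

lemma carried_sum:
  assumes "finite A" "\<And>i. i \<in> A \<Longrightarrow> continuous_map X euclidean (g i)"
  shows "J (\<lambda>x. \<Sum>i\<in>A. a i * g i x) = (\<Sum>i\<in>A. a i * J (g i))"
  using assms
proof (induction A rule: finite_induct)
  case empty
  have "J (\<lambda>x. 0 * 0) = 0 * J (\<lambda>x. 0)" by (rule carried_mult) simp
  then show ?case by simp
next
  case (insert i A)
  have *: "continuous_map X euclidean (\<lambda>x. a j * g j x)" if "j \<in> insert i A" for j
    by (intro continuous_map_mult_complex insert.prems that) simp
  have "J (\<lambda>x. a i * g i x + (\<Sum>i\<in>A. a i * g i x)) = J (\<lambda>x. a i * g i x) + J (\<lambda>x. \<Sum>i\<in>A. a i * g i x)"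
    using * insert.hyps by (intro carried_add continuous_map_sum) auto
  with insert show ?case by (simp add: carried_mult)
qed

lemma carried_continuous:
  assumes F: "continuous_map (prod_topology Z X) euclidean (case_prod F)"
  shows "continuous_map Z euclidean (\<lambda>z. J (F z))"
  unfolding continuous_map_dist_iff
proof (intro ballI allI impI)
  fix z and e :: real assume z: "z \<in> topspace Z" and e: "e > 0"
  define d where "d = e / (c + 1)"
  have d: "d > 0" "c * d < e" using e carried_nonneg by (auto simp: d_def field_simps)
  obtain U where U: "openin Z U" "z \<in> U" "\<And>z' x. z' \<in> U \<Longrightarrow> x \<in> S \<Longrightarrow> norm (F z' x - F z x) < d"
    using uniform_tube[OF F carried_compact z d(1)] by blast
  have "dist (J (F z')) (J (F z)) < e" if "z' \<in> U" for z'
  proof -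
    have "z' \<in> topspace Z" using that U openin_subset by blast
    then have "norm (J (F z') - J (F z)) \<le> c * d"
      using U(3)[OF that] d z
      by (intro carried_diff_bound) (auto intro: less_imp_le continuous_map_section[OF F])
    then show ?thesis using d by (simp add: dist_norm)
  qed
  with U show "\<exists>U. openin Z U \<and> z \<in> U \<and> (\<forall>z'\<in>U. dist (J (F z')) (J (F z)) < e)" by blast
qed

lemma carried_weight:
  assumes w: "continuous_map X euclidean w" and w1: "\<And>x. x \<in> S \<Longrightarrow> norm (w x) \<le> 1"
  shows "carried_functional X S c (\<lambda>g. J (\<lambda>x. w x * g x))"
  unfolding carried_functional_def
proof (intro conjI allI impI carried_compact carried_nonneg)
  fix g h :: "'b \<Rightarrow> complex"
  assume "continuous_map X euclidean g" "continuous_map X euclidean h"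
  then show "J (\<lambda>x. w x * (g x + h x)) = J (\<lambda>x. w x * g x) + J (\<lambda>x. w x * h x)"
    unfolding distrib_left by (intro carried_add continuous_map_mult_complex w)
next
  fix a and g :: "'b \<Rightarrow> complex"
  assume "continuous_map X euclidean g"
  then have "J (\<lambda>x. a * (w x * g x)) = a * J (\<lambda>x. w x * g x)"
    by (intro carried_mult continuous_map_mult_complex w)
  then show "J (\<lambda>x. w x * (a * g x)) = a * J (\<lambda>x. w x * g x)" by (simp add: mult.left_commute)
next
  fix g :: "'b \<Rightarrow> complex" and B :: real
  assume g: "continuous_map X euclidean g" and B: "0 \<le> B" "\<forall>x\<in>S. norm (g x) \<le> B"
  have "norm (w x * g x) \<le> B" if "x \<in> S" for x
    using mult_mono[OF w1[OF that] B(2)[rule_format, OF that]] by (simp add: norm_mult)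
  with g B(1) show "norm (J (\<lambda>x. w x * g x)) \<le> c * B"
    by (intro carried_bound continuous_map_mult_complex w)
qed

end


lemma carried_prod:
  assumes I: "carried_functional X S c I" and J: "carried_functional Y T d J"
  shows "carried_functional (prod_topology X Y) (S \<times> T) (c * d) (\<lambda>g. I (\<lambda>x. J (\<lambda>y. g (x, y))))"
proof -
  have sec: "continuous_map Y euclidean (\<lambda>y. g (x, y))"
    if "continuous_map (prod_topology X Y) euclidean g" "x \<in> topspace X" for g :: "'a \<times> 'b \<Rightarrow> complex" and x
    using continuous_map_section[of X Y euclidean "curry g" x] that by (simp add: curry_def)
  have inner: "continuous_map X euclidean (\<lambda>x. J (\<lambda>y. g (x, y)))"
    if "continuous_map (prod_topology X Y) euclidean g" for g :: "'a \<times> 'b \<Rightarrow> complex"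
    using carried_continuous[OF J, of X "curry g"] that by (simp add: curry_def)
  have S: "S \<subseteq> topspace X" using carried_compact[OF I] by (rule compactin_subset_topspace)
  show ?thesis
    unfolding carried_functional_def
  proof (intro conjI allI impI)
    show "compactin (prod_topology X Y) (S \<times> T)"
      using carried_compact[OF I] carried_compact[OF J] by (simp add: compactin_Times)
    show "0 \<le> c * d" using carried_nonneg[OF I] carried_nonneg[OF J] by simp
  next
    fix g h :: "'a \<times> 'b \<Rightarrow> complex"
    assume g: "continuous_map (prod_topology X Y) euclidean g"
      and h: "continuous_map (prod_topology X Y) euclidean h"
    have "I (\<lambda>x. J (\<lambda>y. g (x, y) + h (x, y))) = I (\<lambda>x. J (\<lambda>y. g (x, y)) + J (\<lambda>y. h (x, y)))"
      using S by (intro carried_cong[OF I] inner continuous_map_add g h carried_add[OF J] sec) auto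
    also have "\<dots> = I (\<lambda>x. J (\<lambda>y. g (x, y))) + I (\<lambda>x. J (\<lambda>y. h (x, y)))"
      by (intro carried_add[OF I] inner g h)
    finally show "I (\<lambda>x. J (\<lambda>y. g (x, y) + h (x, y))) = I (\<lambda>x. J (\<lambda>y. g (x, y))) + I (\<lambda>x. J (\<lambda>y. h (x, y)))" .
  next
    fix a and g :: "'a \<times> 'b \<Rightarrow> complex"
    assume g: "continuous_map (prod_topology X Y) euclidean g"
    have "I (\<lambda>x. J (\<lambda>y. a * g (x, y))) = I (\<lambda>x. a * J (\<lambda>y. g (x, y)))"
      using S by (intro carried_cong[OF I] inner continuous_map_mult_complex g carried_mult[OF J] sec) auto
    also have "\<dots> = a * I (\<lambda>x. J (\<lambda>y. g (x, y)))"
      by (intro carried_mult[OF I] inner g)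
    finally show "I (\<lambda>x. J (\<lambda>y. a * g (x, y))) = a * I (\<lambda>x. J (\<lambda>y. g (x, y)))" .
  next
    fix g :: "'a \<times> 'b \<Rightarrow> complex" and B :: real
    assume g: "continuous_map (prod_topology X Y) euclidean g"
      and B: "0 \<le> B" "\<forall>x\<in>S \<times> T. cmod (g x) \<le> B"
    have "cmod (I (\<lambda>x. J (\<lambda>y. g (x, y)))) \<le> c * (d * B)"
      using S B carried_nonneg[OF J]
      by (intro carried_bound[OF I] inner g carried_bound[OF J] sec) auto
    then show "cmod (I (\<lambda>x. J (\<lambda>y. g (x, y)))) \<le> c * d * B" by (simp add: mult.assoc)
  qed
qed

text \<open>
  The functions \<open>F(-,i)\<close>, for \<open>i\<close> in a finite set \<open>A\<close>, approximate all \<open>F(-,y)\<close> with \<open>y \<in> T\<close>, since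
  \<open>T\<close> is compact and \<open>F(-,y)\<close> depends continuously on \<open>y\<close> in the supremum norm over \<open>S\<close>. A
  partition of unity glues them; its members are built from the supremum distances \<open>D i\<close>
  themselves, which works on every space \<open>Y\<close>, whether or not it has Urysohn functions.
\<close>

lemma separated_approximation:
  fixes F :: "'x \<Rightarrow> 'y \<Rightarrow> complex"
  assumes F: "continuous_map (prod_topology X Y) euclidean (case_prod F)"
    and S: "compactin X S" and T: "compactin Y T" and e: "e > 0"
  obtains A and p :: "'y \<Rightarrow> 'y \<Rightarrow> complex" where
    "finite A" "A \<subseteq> T" "\<And>i. i \<in> A \<Longrightarrow> continuous_map Y euclidean (p i)"
    "\<And>x y. x \<in> S \<Longrightarrow> y \<in> T \<Longrightarrow> norm (F x y - (\<Sum>i\<in>A. F x i * p i y)) \<le> e"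
proof (cases "S = {} \<or> T = {}")
  case True
  then show thesis by (intro that[of "{}"]) auto
next
  case False
  then have ne: "S \<noteq> {}" "T \<noteq> {}" by auto
  have ST: "S \<subseteq> topspace X" "T \<subseteq> topspace Y"
    using S T compactin_subset_topspace by blast+
  have F': "continuous_map (prod_topology Y X) euclidean (case_prod (\<lambda>y x. F x y))"
    using continuous_map_swap_args[OF F] by simp
  note sec = continuous_map_section[OF F']
  define D where "D i y = (SUP x\<in>S. norm (F x y - F x i))" for i y
  have bdd: "bdd_above ((\<lambda>x. norm (F x y - F x i)) ` S)" if "i \<in> T" "y \<in> topspace Y" for i y
  proof -
    have "compactin euclidean ((\<lambda>x. norm (F x y - F x i)) ` S)"
      using that ST by (intro image_compactin[OF S] continuous_map_diff_norm sec) auto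
    then show ?thesis
      by (simp add: compact_imp_bounded bounded_imp_bdd_above)
  qed
  have D_ge: "norm (F x y - F x i) \<le> D i y" if "x \<in> S" "i \<in> T" "y \<in> topspace Y" for x i y
    unfolding D_def using that bdd by (intro cSUP_upper) auto
  have D_lip: "D i y' \<le> D i y + b"
    if "i \<in> T" "y \<in> topspace Y" "y' \<in> topspace Y" "\<And>x. x \<in> S \<Longrightarrow> norm (F x y' - F x y) \<le> b" for i y y' b
    unfolding D_def[of i y']
  proof (rule cSUP_least[OF ne(1)])
    fix x assume x: "x \<in> S"
    have "norm (F x y' - F x i) \<le> norm (F x y - F x i) + norm (F x y' - F x y)"
      using norm_triangle_ineq[of "F x y - F x i" "F x y' - F x y"] by simp
    then show "norm (F x y' - F x i) \<le> D i y + b"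
      using D_ge[OF x that(1,2)] that(4)[OF x] by linarith
  qed
  have D_cont: "continuous_map Y euclideanreal (D i)" if i: "i \<in> T" for i
    unfolding continuous_map_dist_iff
  proof (intro ballI allI impI)
    fix y and r :: real assume y: "y \<in> topspace Y" and r: "r > 0"
    obtain U where U: "openin Y U" "y \<in> U"
      "\<And>y' x. y' \<in> U \<Longrightarrow> x \<in> S \<Longrightarrow> norm (F x y' - F x y) < r / 2"
      using uniform_tube[OF F' S y, of "r / 2"] r by auto
    have "dist (D i y') (D i y) < r" if "y' \<in> U" for y'
    proof -
      have y': "y' \<in> topspace Y" using that U openin_subset by blast
      have "norm (F x y' - F x y) \<le> r / 2" "norm (F x y - F x y') \<le> r / 2" if "x \<in> S" for x
        using U(3)[OF \<open>y' \<in> U\<close> that] by (simp_all add: norm_minus_commute)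
      then have "D i y' \<le> D i y + r / 2" "D i y \<le> D i y' + r / 2"
        using y y' i D_lip by blast+
      then show ?thesis using r unfolding dist_real_def by linarith
    qed
    with U show "\<exists>U. openin Y U \<and> y \<in> U \<and> (\<forall>y'\<in>U. dist (D i y') (D i y) < r)" by blast
  qed
  define V where "V i = {y \<in> topspace Y. D i y \<in> {..<e}}" for i
  have Vo: "openin Y (V i)" if "i \<in> T" for i
    unfolding V_def by (rule openin_continuous_map_preimage[OF D_cont[OF that]]) simp
  have "D i i = 0" if "i \<in> T" for i using ne by (simp add: D_def)
  then have "T \<subseteq> \<Union> (V ` T)" using ST e by (auto simp: V_def)
  then obtain \<V> where "finite \<V>" "\<V> \<subseteq> V ` T" "T \<subseteq> \<Union> \<V>"
    using T Vo unfolding compactin_def by (metis (no_types, lifting) imageE)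
  then obtain A where A: "finite A" "A \<subseteq> T" "T \<subseteq> (\<Union>i\<in>A. V i)"
    using finite_subset_image[of \<V> V T] by blast
  \<comment> \<open>Cutoffs that vanish where \<open>F(-,i)\<close> is a poor approximation; on \<open>T\<close> their sum \<open>Q\<close> is positive.\<close>
  define q where "q i y = max 0 (e - D i y)" for i y
  define Q where "Q y = (\<Sum>i\<in>A. q i y)" for y
  have q_cont: "continuous_map Y euclideanreal (q i)" if "i \<in> A" for i
    unfolding q_def using that A by (intro continuous_map_real_max continuous_map_diff D_cont) auto
  have Q_cont: "continuous_map Y euclideanreal Q"
    unfolding Q_def using A by (intro continuous_map_sum q_cont) auto
  have Q_pos: "Q y > 0" if y: "y \<in> T" for y
  proof -
    obtain i where "i \<in> A" "y \<in> V i" using A y by blast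
    then show ?thesis unfolding Q_def
      by (intro sum_pos2[OF A(1)]) (auto simp: q_def V_def)
  qed
  have "compact (Q ` T)" using image_compactin[OF T Q_cont] by simp
  then obtain m where m: "m \<in> Q ` T" "\<And>y. y \<in> T \<Longrightarrow> m \<le> Q y"
    using compact_attains_inf[of "Q ` T"] ne by auto
  have m0: "m > 0" using m Q_pos by auto
  \<comment> \<open>The lower bound \<open>m\<close> keeps the quotient continuous outside \<open>T\<close>, where \<open>Q\<close> may vanish.\<close>
  define p where "p i y = complex_of_real (q i y / max m (Q y))" for i y
  have p_cont: "continuous_map Y euclidean (p i)" if "i \<in> A" for i
    unfolding p_def using m0 that
    by (intro continuous_map_of_real continuous_map_real_divide q_cont continuous_map_real_max Q_cont) auto
  show thesis
  proof (rule that[OF A(1,2) p_cont])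
    fix x y assume x: "x \<in> S" and y: "y \<in> T"
    have Qy: "max m (Q y) = Q y" "Q y \<noteq> 0" using m(2)[OF y] Q_pos[OF y] by auto
    have one: "(\<Sum>i\<in>A. p i y) = 1"
      using Qy by (simp add: p_def flip: of_real_sum sum_divide_distrib) (simp add: Q_def)
    have "F x y - (\<Sum>i\<in>A. F x i * p i y) = (\<Sum>i\<in>A. (F x y - F x i) * p i y)"
      using one by (simp add: left_diff_distrib sum_subtractf flip: sum_distrib_left)
    also have "norm \<dots> \<le> (\<Sum>i\<in>A. e * (q i y / Q y))"
    proof (rule sum_norm_le)
      fix i assume i: "i \<in> A"
      have "norm (F x y - F x i) * q i y \<le> e * q i y"
        using order_trans[OF D_ge[OF x, of i y], of e] i A y ST
        by (cases "D i y < e") (auto simp: q_def intro!: mult_right_mono)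
      moreover have "norm (p i y) = q i y / Q y"
        using Qy Q_pos[OF y] by (auto simp: p_def norm_divide q_def)
      ultimately show "norm ((F x y - F x i) * p i y) \<le> e * (q i y / Q y)"
        using Q_pos[OF y] by (simp add: norm_mult divide_right_mono)
    qed
    also have "\<dots> = e"
      using Qy by (simp flip: sum_distrib_left sum_divide_distrib) (simp add: Q_def)
    finally show "norm (F x y - (\<Sum>i\<in>A. F x i * p i y)) \<le> e" .
  qed
qed

text \<open>
  For a finite sum of products both iterated values are the same finite sum, and every continuous
  \<open>F\<close> is uniformly close to such a sum on the compact sets that carry \<open>I\<close> and \<open>J\<close>.
\<close>

lemma carried_Fubini:
  assumes I: "carried_functional X S c I" and J: "carried_functional Y T d J"
    and F: "continuous_map (prod_topology X Y) euclidean (case_prod F)"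
  shows "I (\<lambda>x. J (F x)) = J (\<lambda>y. I (\<lambda>x. F x y))"
proof -
  have F': "continuous_map (prod_topology Y X) euclidean (case_prod (\<lambda>y x. F x y))"
    using continuous_map_swap_args[OF F] by simp
  note sec = continuous_map_section[OF F] and sec' = continuous_map_section[OF F']
  note c0 = carried_nonneg[OF I] and d0 = carried_nonneg[OF J]
  have ST: "S \<subseteq> topspace X" "T \<subseteq> topspace Y"
    using carried_compact[OF I] carried_compact[OF J] compactin_subset_topspace by blast+
  have main: "norm (I (\<lambda>x. J (F x)) - J (\<lambda>y. I (\<lambda>x. F x y))) \<le> 2 * (c * d) * e" if e: "e > 0" for e
  proof -
    obtain A p where A: "finite A" "A \<subseteq> T" "\<And>i. i \<in> A \<Longrightarrow> continuous_map Y euclidean (p i)"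
      and approx: "\<And>x y. x \<in> S \<Longrightarrow> y \<in> T \<Longrightarrow> norm (F x y - (\<Sum>i\<in>A. F x i * p i y)) \<le> e"
      using separated_approximation[OF F carried_compact[OF I] carried_compact[OF J] e] by metis
    have Fi: "continuous_map X euclidean (\<lambda>x. F x i)" if "i \<in> A" for i
      using sec' that A ST by blast
    define Z where "Z = (\<Sum>i\<in>A. J (p i) * I (\<lambda>x. F x i))"
    have "norm (I (\<lambda>x. J (F x)) - I (\<lambda>x. \<Sum>i\<in>A. J (p i) * F x i)) \<le> c * (d * e)"
    proof (rule carried_diff_bound[OF I carried_continuous[OF J F]])
      show "continuous_map X euclidean (\<lambda>x. \<Sum>i\<in>A. J (p i) * F x i)"
        by (intro continuous_map_sum continuous_map_mult_complex A Fi) auto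
      show "0 \<le> d * e" using d0 e by simp
      fix x assume x: "x \<in> S"
      have "norm (J (F x) - J (\<lambda>y. \<Sum>i\<in>A. F x i * p i y)) \<le> d * e"
        using x ST e approx[OF x]
        by (intro carried_diff_bound[OF J] sec continuous_map_sum continuous_map_mult_complex A) auto
      then show "norm (J (F x) - (\<Sum>i\<in>A. J (p i) * F x i)) \<le> d * e"
        by (simp add: carried_sum[OF J A(1,3)] mult.commute)
    qed
    then have 1: "norm (I (\<lambda>x. J (F x)) - Z) \<le> c * d * e"
      by (simp add: carried_sum[OF I A(1) Fi] Z_def mult.assoc)
    have "norm (J (\<lambda>y. I (\<lambda>x. F x y)) - J (\<lambda>y. \<Sum>i\<in>A. I (\<lambda>x. F x i) * p i y)) \<le> d * (c * e)"
    proof (rule carried_diff_bound[OF J carried_continuous[OF I F']])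
      show "continuous_map Y euclidean (\<lambda>y. \<Sum>i\<in>A. I (\<lambda>x. F x i) * p i y)"
        by (intro continuous_map_sum continuous_map_mult_complex A) auto
      show "0 \<le> c * e" using c0 e by simp
      fix y assume y: "y \<in> T"
      have "norm (I (\<lambda>x. F x y) - I (\<lambda>x. \<Sum>i\<in>A. p i y * F x i)) \<le> c * e"
        using y ST e approx[OF _ y]
        by (intro carried_diff_bound[OF I] sec' continuous_map_sum continuous_map_mult_complex A Fi)
           (auto simp: mult.commute)
      moreover have "I (\<lambda>x. \<Sum>i\<in>A. p i y * F x i) = (\<Sum>i\<in>A. I (\<lambda>x. F x i) * p i y)"
        using carried_sum[OF I A(1), of "\<lambda>i x. F x i" "\<lambda>i. p i y", OF Fi] by (simp add: mult.commute)
      ultimately show "norm (I (\<lambda>x. F x y) - (\<Sum>i\<in>A. I (\<lambda>x. F x i) * p i y)) \<le> c * e"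
        by simp
    qed
    moreover have "J (\<lambda>y. \<Sum>i\<in>A. I (\<lambda>x. F x i) * p i y) = Z"
      using carried_sum[OF J A(1), of p "\<lambda>i. I (\<lambda>x. F x i)", OF A(3)] by (simp add: Z_def mult.commute)
    ultimately have 2: "norm (J (\<lambda>y. I (\<lambda>x. F x y)) - Z) \<le> c * d * e"
      by (simp add: mult.assoc mult.left_commute)
    show ?thesis
      using norm_triangle_sub[of "I (\<lambda>x. J (F x)) - Z" "J (\<lambda>y. I (\<lambda>x. F x y)) - Z"]
        norm_triangle_ineq4[of "I (\<lambda>x. J (F x)) - Z" "J (\<lambda>y. I (\<lambda>x. F x y)) - Z"] 1 2
      by simp
  qed
  have "norm (I (\<lambda>x. J (F x)) - J (\<lambda>y. I (\<lambda>x. F x y))) = 0"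
    by (rule le_small_multiples_imp_zero[OF _ _ main]) (use c0 d0 in auto)
  then show ?thesis by simp
qed

section \<open>Integration against a complex measure\<close>

lemma ennreal_add_le: "ennreal (a + b) \<le> ennreal a + ennreal b"
proof (cases "a \<ge> 0 \<and> b \<ge> 0")
  case True
  then show ?thesis by (simp add: ennreal_plus)
next
  case False
  then consider "a + b \<le> a" | "a + b \<le> b" by linarith
  then show ?thesis
    by cases (metis add_increasing2 ennreal_leI zero_le, metis add_increasing ennreal_leI zero_le)
qed

text \<open>
  The uniform bound makes the positive and negative parts finite measures; for the real and
  imaginary parts of a complex measure the total variation provides it.
\<close>

definition signed_measure :: "('a::topological_space set \<Rightarrow> real) \<Rightarrow> bool" where
  "signed_measure \<nu> \<longleftrightarrow>
     (\<forall>A :: nat \<Rightarrow> 'a set. range A \<subseteq> sets borel \<longrightarrow> disjoint_family A \<longrightarrow>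
        (\<lambda>n. \<nu> (A n)) sums \<nu> (\<Union>n. A n)) \<and>
     (\<exists>c. \<forall>A\<in>sets borel. \<bar>\<nu> A\<bar> \<le> c)"

lemma countably_additive_empty:
  fixes \<nu> :: "'a set \<Rightarrow> 'b::real_normed_vector"
  assumes "(\<lambda>n::nat. \<nu> {}) sums z"
  shows "\<nu> {} = 0"
  using summable_LIMSEQ_zero[OF sums_summable[OF assms]] by (simp add: LIMSEQ_const_iff)

lemma countably_additive_Un:
  fixes \<nu> :: "'a::topological_space set \<Rightarrow> 'b::real_normed_vector"
  assumes \<nu>: "\<And>A :: nat \<Rightarrow> 'a set. range A \<subseteq> sets borel \<Longrightarrow> disjoint_family A \<Longrightarrow>
        (\<lambda>n. \<nu> (A n)) sums \<nu> (\<Union>n. A n)"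
    and "A \<in> sets borel" "B \<in> sets borel" "A \<inter> B = {}"
  shows "\<nu> (A \<union> B) = \<nu> A + \<nu> B"
proof -
  have "\<nu> {} = 0"
    using \<nu>[of "\<lambda>_. {}"] by (intro countably_additive_empty) (auto simp: disjoint_family_on_def)
  then have "(\<lambda>n. \<nu> (binaryset A B n)) sums (\<nu> A + \<nu> B)" by (rule binaryset_sums)
  moreover have "(\<lambda>n. \<nu> (binaryset A B n)) sums \<nu> (\<Union>n. binaryset A B n)"
    using assms(2-) by (intro \<nu>)
      (auto simp: range_binaryset_eq disjoint_family_on_def binaryset_def)
  ultimately show ?thesis
    using sums_unique2 by (fastforce simp: UN_binaryset_eq)
qed

context
  fixes \<nu> :: "'a::topological_space set \<Rightarrow> real"
  assumes \<nu>: "signed_measure \<nu>"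
begin

private lemma sums: "range A \<subseteq> sets borel \<Longrightarrow> disjoint_family A \<Longrightarrow> (\<lambda>n::nat. \<nu> (A n)) sums \<nu> (\<Union>n. A n)"
  using \<nu> unfolding signed_measure_def by blast

private lemma empty: "\<nu> {} = 0"
  using sums[of "\<lambda>_. {}"] by (intro countably_additive_empty) (auto simp: disjoint_family_on_def)

private lemmas Un = countably_additive_Un[of \<nu>, OF sums]

private definition "P A = (SUP B \<in> {B \<in> sets borel. B \<subseteq> A}. ennreal (\<nu> B))"

private lemma P_upper: "B \<in> sets borel \<Longrightarrow> B \<subseteq> A \<Longrightarrow> ennreal (\<nu> B) \<le> P A"
  unfolding P_def by (rule SUP_upper) auto

private lemma P_least: "(\<And>B. B \<in> sets borel \<Longrightarrow> B \<subseteq> A \<Longrightarrow> ennreal (\<nu> B) \<le> x) \<Longrightarrow> P A \<le> x"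
  unfolding P_def by (rule SUP_least) auto

text \<open>
  Near-optimal subsets of \<open>A\<close> and of \<open>B\<close> are disjoint, so their union competes in the supremum for
  \<open>C\<close>; a subset of negative measure is replaced by the other one alone.
\<close>

private lemma P_superadditive:
  assumes "A \<inter> B = {}" "A \<union> B \<subseteq> C"
  shows "P A + P B \<le> P C"
proof -
  have *: "ennreal (\<nu> A') + ennreal (\<nu> B') \<le> P C"
    if A': "A' \<in> sets borel" "A' \<subseteq> A" and B': "B' \<in> sets borel" "B' \<subseteq> B" for A' B'
  proof -
    have "\<nu> A' \<le> 0 \<or> \<nu> B' \<le> 0 \<or> ennreal (\<nu> A') + ennreal (\<nu> B') = ennreal (\<nu> (A' \<union> B'))"
      using that assms by (subst Un) (auto simp flip: ennreal_plus)
    moreover have "ennreal (\<nu> (A' \<union> B')) \<le> P C" "ennreal (\<nu> A') \<le> P C" "ennreal (\<nu> B') \<le> P C"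
      using that assms by (auto intro!: P_upper)
    ultimately show ?thesis by (auto simp: ennreal_neg)
  qed
  have "P A + P B = (SUP A' \<in> {A' \<in> sets borel. A' \<subseteq> A}. SUP B' \<in> {B' \<in> sets borel. B' \<subseteq> B}.
      ennreal (\<nu> A') + ennreal (\<nu> B'))"
    unfolding P_def
    by (subst ennreal_SUP_add_left[symmetric], force, subst ennreal_SUP_add_right[symmetric], force) simp
  also have "\<dots> \<le> P C" using * by (auto intro!: SUP_least)
  finally show ?thesis .
qed

text \<open>
  One inequality passes superadditivity to the limit; for the other, a competitor \<open>B\<close> for the union
  is cut into its pieces \<open>B \<inter> A n\<close>.
\<close>

private lemma P_countably_additive: "countably_additive (sets borel) P"
proof (rule countably_additiveI)
  fix A :: "nat \<Rightarrow> 'a set"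
  assume A: "range A \<subseteq> sets borel" "disjoint_family A"
  show "(\<Sum>n. P (A n)) = P (\<Union>n. A n)"
  proof (rule antisym)
    have part: "(\<Sum>n<N. P (A n)) \<le> P (\<Union>n<N. A n)" for N
    proof (induction N)
      case 0
      then show ?case by simp
    next
      case (Suc N)
      have "(\<Sum>n<Suc N. P (A n)) \<le> P (\<Union>n<N. A n) + P (A N)"
        using Suc by (simp add: add_right_mono)
      also have "\<dots> \<le> P (\<Union>n<Suc N. A n)"
        using A(2) by (intro P_superadditive)
          (auto simp: disjoint_family_on_def lessThan_Suc, metis IntI emptyE less_irrefl)
      finally show ?case .
    qed
    have "P (\<Union>n<N. A n) \<le> P (\<Union>n. A n)" for N
      by (intro P_least P_upper) auto
    with part show "(\<Sum>n. P (A n)) \<le> P (\<Union>n. A n)"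
      unfolding suminf_eq_SUP by (intro SUP_least) (meson order_trans)
  next
    show "P (\<Union>n. A n) \<le> (\<Sum>n. P (A n))"
    proof (rule P_least)
      fix B assume B: "B \<in> sets borel" "B \<subseteq> (\<Union>n. A n)"
      have "(\<lambda>n. \<nu> (B \<inter> A n)) sums \<nu> (\<Union>n. B \<inter> A n)"
        using A B by (intro sums) (auto simp: disjoint_family_on_def)
      moreover have "(\<Union>n. B \<inter> A n) = B" using B by auto
      ultimately have "(\<lambda>N. ennreal (\<Sum>n<N. \<nu> (B \<inter> A n))) \<longlonglongrightarrow> ennreal (\<nu> B)"
        unfolding sums_def by (intro tendsto_ennrealI) simp
      moreover have "ennreal (\<Sum>n<N. \<nu> (B \<inter> A n)) \<le> (\<Sum>n. P (A n))" for N
      proof -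
        have "ennreal (\<Sum>n<N. \<nu> (B \<inter> A n)) \<le> (\<Sum>n<N. ennreal (\<nu> (B \<inter> A n)))"
          by (induction N) (auto intro: order_trans[OF ennreal_add_le] add_right_mono)
        also have "\<dots> \<le> (\<Sum>n<N. P (A n))"
          using A B by (intro sum_mono P_upper) auto
        also have "\<dots> \<le> (\<Sum>n. P (A n))" by (rule sum_le_suminf) auto
        finally show ?thesis .
      qed
      ultimately show "ennreal (\<nu> B) \<le> (\<Sum>n. P (A n))"
        by (intro LIMSEQ_le_const2) auto
    qed
  qed
qed

lemma space_positive_part: "space (positive_part \<nu>) = UNIV"
  by (simp add: positive_part_def space_measure_of_conv)

lemma sets_positive_part: "sets (positive_part \<nu>) = sets borel"
  using sets.sigma_sets_eq[of "borel :: 'a measure"]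
  by (simp add: positive_part_def sets_measure_of_conv)

lemma emeasure_positive_part:
  assumes "A \<in> sets borel"
  shows "emeasure (positive_part \<nu>) A = (SUP B \<in> {B \<in> sets borel. B \<subseteq> A}. ennreal (\<nu> B))"
proof -
  have "P {} \<le> 0" by (rule P_least) (simp add: empty)
  then have "positive (sets borel) P" by (simp add: positive_def)
  moreover have "sigma_algebra UNIV (sets (borel :: 'a measure))"
    using sets.sigma_algebra_axioms[of "borel :: 'a measure"] by simp
  ultimately have "emeasure (measure_of UNIV (sets borel) P) A = P A"
    using P_countably_additive assms by (intro emeasure_measure_of_sigma)
  then show ?thesis by (simp add: positive_part_def P_def[abs_def])
qed

lemma finite_measure_positive_part: "finite_measure (positive_part \<nu>)"
proof
  obtain c where "\<And>A. A \<in> sets borel \<Longrightarrow> \<bar>\<nu> A\<bar> \<le> c" using \<nu> by (auto simp: signed_measure_def)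
  then have "P UNIV \<le> ennreal c"
    by (intro P_least ennreal_leI) (meson abs_le_D1)
  then have "P UNIV < \<infinity>" by (rule le_less_trans) simp
  moreover have "emeasure (positive_part \<nu>) UNIV = P UNIV"
    unfolding P_def by (rule emeasure_positive_part) simp
  ultimately show "emeasure (positive_part \<nu>) (space (positive_part \<nu>)) \<noteq> \<infinity>"
    unfolding space_positive_part by (metis less_irrefl)
qed

lemma signed_measure_uminus: "signed_measure (\<lambda>A. - \<nu> A)"
  using \<nu> unfolding signed_measure_def by (auto intro: sums_minus)

lemma measure_positive_part_upper:
  assumes "B \<in> sets borel" "B \<subseteq> A" "A \<in> sets borel"
  shows "\<nu> B \<le> measure (positive_part \<nu>) A"
proof -
  interpret finite_measure "positive_part \<nu>" by (rule finite_measure_positive_part)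
  have "ennreal (\<nu> B) \<le> ennreal (measure (positive_part \<nu>) A)"
    using P_upper[OF assms(1,2)] emeasure_positive_part[OF assms(3)]
    by (simp add: emeasure_eq_measure P_def)
  then show ?thesis
    by (metis ennreal_le_iff measure_nonneg)
qed

lemma measure_positive_part_least:
  assumes "A \<in> sets borel" "\<And>B. B \<in> sets borel \<Longrightarrow> B \<subseteq> A \<Longrightarrow> \<nu> B \<le> x"
  shows "measure (positive_part \<nu>) A \<le> x"
proof -
  interpret finite_measure "positive_part \<nu>" by (rule finite_measure_positive_part)
  have x: "0 \<le> x" using assms(2)[of "{}"] empty by simp
  have "P A \<le> ennreal x" using assms(2) by (intro P_least ennreal_leI)
  then have "ennreal (measure (positive_part \<nu>) A) \<le> ennreal x"
    using emeasure_positive_part[OF assms(1)] by (simp add: emeasure_eq_measure P_def)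
  then show ?thesis using x by simp
qed

lemma signed_measure_Diff:
  assumes "A \<in> sets borel" "B \<in> sets borel" "B \<subseteq> A"
  shows "\<nu> (A - B) = \<nu> A - \<nu> B"
  using Un[of B "A - B"] assms by (simp add: Un_absorb1)

end

text \<open>
  For \<open>B \<subseteq> A\<close> one has \<open>\<nu> B = \<nu> A - \<nu> (A - B)\<close>, and \<open>- \<nu> (A - B)\<close> is at most the negative part of \<open>A\<close>.
  This gives one inequality; the other is the same for \<open>- \<nu>\<close>.
\<close>

lemma Jordan_decomposition:
  assumes \<nu>: "signed_measure \<nu>" and A: "A \<in> sets borel"
  shows "measure (positive_part \<nu>) A - measure (positive_part (\<lambda>A. - \<nu> A)) A = \<nu> A"
proof -
  have le: "measure (positive_part \<sigma>) A \<le> \<sigma> A + measure (positive_part (\<lambda>A. - \<sigma> A)) A"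
    if \<sigma>: "signed_measure \<sigma>" for \<sigma>
  proof (rule measure_positive_part_least[OF \<sigma> A])
    fix B assume B: "B \<in> sets borel" "B \<subseteq> A"
    have "- \<sigma> (A - B) \<le> measure (positive_part (\<lambda>A. - \<sigma> A)) A"
      using A B by (intro measure_positive_part_upper signed_measure_uminus \<sigma>) auto
    then show "\<sigma> B \<le> \<sigma> A + measure (positive_part (\<lambda>A. - \<sigma> A)) A"
      using signed_measure_Diff[OF \<sigma> A B] by simp
  qed
  from le[OF \<nu>] le[OF signed_measure_uminus[OF \<nu>]] show ?thesis by simp
qed

text \<open>
  A finite disjoint family becomes a countable partition of \<open>C\<close> by adding the remainder of \<open>C\<close> and empty sets.
\<close>

lemma total_variation_upper:
  fixes A :: "nat \<Rightarrow> 'a::topological_space set"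
  assumes "\<And>n. n < N \<Longrightarrow> A n \<in> sets borel" "disjoint_family_on A {..<N}"
    and "C \<in> sets borel" "\<And>n. n < N \<Longrightarrow> A n \<subseteq> C"
  shows "ennreal (\<Sum>n<N. cmod (\<mu> (A n))) \<le> total_variation \<mu> C"
proof -
  define E where "E n = (if n < N then A n else if n = N then C - (\<Union>i<N. A i) else {})" for n
  have "range E \<subseteq> sets borel" using assms by (auto simp: E_def)
  moreover have "disjoint_family E"
    unfolding disjoint_family_on_def
  proof (intro ballI impI)
    fix m n :: nat assume "m \<noteq> n"
    then show "E m \<inter> E n = {}"
      using assms(2) unfolding disjoint_family_on_def E_def by (cases "m < N"; cases "n < N") auto
  qed
  moreover have "(\<Union>n. E n) = C"
  proof
    show "(\<Union>n. E n) \<subseteq> C" using assms(4) by (auto simp: E_def split: if_splits)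
    show "C \<subseteq> (\<Union>n. E n)"
    proof
      fix x assume x: "x \<in> C"
      show "x \<in> (\<Union>n. E n)"
      proof (cases "\<exists>i<N. x \<in> A i")
        case True
        then obtain i where "i < N" "x \<in> A i" by auto
        then have "x \<in> E i" by (simp add: E_def)
        then show ?thesis by blast
      next
        case False
        with x have "x \<in> E N" by (simp add: E_def)
        then show ?thesis by blast
      qed
    qed
  qed
  ultimately have "(\<Sum>n. ennreal (cmod (\<mu> (E n)))) \<le> total_variation \<mu> C"
    unfolding total_variation_def by (intro SUP_upper) auto
  moreover have "(\<Sum>n<N. ennreal (cmod (\<mu> (E n)))) \<le> (\<Sum>n. ennreal (cmod (\<mu> (E n))))"
    by (rule sum_le_suminf) auto
  moreover have "(\<Sum>n<N. ennreal (cmod (\<mu> (E n)))) = ennreal (\<Sum>n<N. cmod (\<mu> (A n)))"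
    by (simp add: E_def)
  ultimately show ?thesis by simp
qed

lemma cmod_le_total_variation:
  assumes "B \<in> sets borel" "B \<subseteq> C" "C \<in> sets borel"
  shows "ennreal (cmod (\<mu> B)) \<le> total_variation \<mu> C"
  using total_variation_upper[of 1 "\<lambda>_. B" C \<mu>] assms by (simp add: disjoint_family_on_def)

lemma measurable_Least_ball:
  fixes g :: "'a \<Rightarrow> complex"
  assumes "g \<in> borel_measurable M"
  shows "{x \<in> space M. (LEAST i::nat. dist (c i) (g x) < e) = i} \<in> sets M"
proof -
  have "(\<lambda>x. LEAST i. dist (c i) (g x) < e) \<in> measurable M (count_space UNIV)"
    using assms by measurable
  then show ?thesis by measurable
qed

context
  fixes \<mu> :: "'a::t2_space set \<Rightarrow> complex"
  assumes \<mu>: "complex_measure \<mu>" and supp: "compact (measure_support \<mu>)"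
begin

private lemma mu_sums: "range A \<subseteq> sets borel \<Longrightarrow> disjoint_family A \<Longrightarrow> (\<lambda>n::nat. \<mu> (A n)) sums \<mu> (\<Union>n. A n)"
  using \<mu> unfolding complex_measure_def countably_additive_borel_def by blast

private lemmas mu_Un = countably_additive_Un[of \<mu>, OF mu_sums]

lemma sum_cmod_le_measure_norm:
  fixes A :: "nat \<Rightarrow> 'a set"
  assumes "\<And>n. n < N \<Longrightarrow> A n \<in> sets borel" "disjoint_family_on A {..<N}"
  shows "(\<Sum>n<N. cmod (\<mu> (A n))) \<le> measure_norm \<mu>"
proof -
  have "total_variation \<mu> UNIV < top_class.top" using \<mu> by (simp add: complex_measure_def)
  then have "ennreal (measure_norm \<mu>) = total_variation \<mu> UNIV"
    unfolding measure_norm_def by (rule ennreal_enn2real)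
  moreover have "ennreal (\<Sum>n<N. cmod (\<mu> (A n))) \<le> total_variation \<mu> UNIV"
    using assms by (intro total_variation_upper) auto
  moreover have "0 \<le> measure_norm \<mu>" by (simp add: measure_norm_def)
  ultimately show ?thesis by (simp flip: ennreal_le_iff)
qed

private lemma cmod_le: "A \<in> sets borel \<Longrightarrow> cmod (\<mu> A) \<le> measure_norm \<mu>"
  using sum_cmod_le_measure_norm[of 1 "\<lambda>_. A"] by (simp add: disjoint_family_on_def)

lemma signed_measure_Re: "signed_measure (\<lambda>A. Re (\<mu> A))"
  unfolding signed_measure_def
  using mu_sums cmod_le by (auto intro: sums_Re exI[of _ "measure_norm \<mu>"] order_trans[OF abs_Re_le_cmod])

lemma signed_measure_Im: "signed_measure (\<lambda>A. Im (\<mu> A))"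
  unfolding signed_measure_def
  using mu_sums cmod_le by (auto intro: sums_Im exI[of _ "measure_norm \<mu>"] order_trans[OF abs_Im_le_cmod])

text \<open>
  The complement of the support is covered by open null sets, so compact subsets of it are null;
  inner regularity of the total variation carries this over to the whole complement.
\<close>

lemma vanishes_off_support:
  assumes "B \<in> sets borel" "B \<inter> measure_support \<mu> = {}"
  shows "\<mu> B = 0"
proof -
  define null where "null C \<longleftrightarrow> (\<forall>B\<in>sets borel. B \<subseteq> C \<longrightarrow> \<mu> B = 0)" for C
  have nullD: "\<mu> B = 0" if "null C" "B \<in> sets borel" "B \<subseteq> C" for B C
    using that unfolding null_def by blast
  have null_Un: "null (U \<union> V)" if "null U" "null V" "U \<in> sets borel" for U V
    unfolding null_def
  proof (intro ballI impI)
    fix B assume B: "B \<in> sets borel" "B \<subseteq> U \<union> V"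
    have "\<mu> (B \<inter> U) = 0" by (rule nullD[OF that(1)]) (use B that in auto)
    moreover have "\<mu> (B - U) = 0" by (rule nullD[OF that(2)]) (use B that in auto)
    moreover have "\<mu> (B \<inter> U \<union> (B - U)) = \<mu> (B \<inter> U) + \<mu> (B - U)"
      using B that by (intro mu_Un) auto
    moreover have "B \<inter> U \<union> (B - U) = B" by blast
    ultimately show "\<mu> B = 0" by simp
  qed
  have open_null: "\<exists>U. open U \<and> x \<in> U \<and> null U" if "x \<notin> measure_support \<mu>" for x
  proof -
    obtain U where U: "open U" "x \<in> U" "total_variation \<mu> U = 0"
      using \<open>x \<notin> measure_support \<mu>\<close> by (auto simp: measure_support_def)
    have "\<mu> B = 0" if B: "B \<in> sets borel" "B \<subseteq> U" for B
    proof -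
      have "ennreal (cmod (\<mu> B)) \<le> total_variation \<mu> U" using U B by (intro cmod_le_total_variation) auto
      then show ?thesis using U by simp
    qed
    with U show ?thesis unfolding null_def by blast
  qed
  have compact_null: "null C" if C: "compact C" "C \<inter> measure_support \<mu> = {}" for C
  proof -
    obtain U where U: "\<And>x. x \<notin> measure_support \<mu> \<Longrightarrow> open (U x) \<and> x \<in> U x \<and> null (U x)"
      using open_null by metis
    obtain D where D: "D \<subseteq> C" "finite D" "C \<subseteq> (\<Union>x\<in>D. U x)"
    proof (rule compactE_image[OF C(1), of C U])
      show "open (U x)" if "x \<in> C" for x using U[of x] that C(2) by blast
      show "C \<subseteq> (\<Union>x\<in>C. U x)" using U C(2) by blast
    qed
    have "D \<inter> measure_support \<mu> = {}" using D C by blast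
    with D(2) have "null (\<Union>x\<in>D. U x)"
    proof (induction D rule: finite_induct)
      case empty
      have "\<mu> {} = 0"
        using mu_sums[of "\<lambda>_. {}"] by (intro countably_additive_empty) (auto simp: disjoint_family_on_def)
      then show ?case by (simp add: null_def)
    next
      case (insert x D)
      then have "null (U x \<union> (\<Union>x\<in>D. U x))"
        using U[of x] by (intro null_Un) auto
      then show ?case by simp
    qed
    then show ?thesis unfolding null_def using D(3) by blast
  qed
  have "closed (measure_support \<mu>)" using supp by (rule compact_imp_closed)
  then have "- (measure_support \<mu>) \<in> borel_sets_of euclidean"
    unfolding borel_sets_of_def by (intro sigma_sets.Basic) (simp add: open_Compl)
  then have "total_variation \<mu> (- (measure_support \<mu>)) = (SUP C \<in> {C. compactin euclidean C \<and> C \<subseteq> - (measure_support \<mu>)}. total_variation \<mu> C)"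
    using \<mu> unfolding complex_measure_def regular_on_def by blast
  also have "\<dots> \<le> 0"
  proof (rule SUP_least)
    fix C assume "C \<in> {C. compactin euclidean C \<and> C \<subseteq> - (measure_support \<mu>)}"
    then have "compact C" "C \<inter> measure_support \<mu> = {}" by auto
    then have C: "null C" by (rule compact_null)
    show "total_variation \<mu> C \<le> 0"
      unfolding total_variation_def
    proof (rule SUP_least)
      fix E :: "nat \<Rightarrow> 'a set"
      assume "E \<in> {E. range E \<subseteq> sets borel \<and> disjoint_family E \<and> (\<Union>n. E n) = C}"
      then have "E n \<in> sets borel" "E n \<subseteq> C" for n by blast+
      then have "\<mu> (E n) = 0" for n by (rule nullD[OF C])
      then show "(\<Sum>n. ennreal (cmod (\<mu> (E n)))) \<le> 0" by simp
    qed
  qed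
  finally have "total_variation \<mu> (- (measure_support \<mu>)) = 0" by simp
  moreover have "ennreal (cmod (\<mu> B)) \<le> total_variation \<mu> (- (measure_support \<mu>))"
    using assms \<open>closed (measure_support \<mu>)\<close> by (intro cmod_le_total_variation) auto
  ultimately show ?thesis by simp
qed

private definition "finite_on_support M \<longleftrightarrow> finite_measure M \<and> sets M = sets borel \<and> (AE x in M. x \<in> measure_support \<mu>)"

private lemma positive_part_finite_on_support:
  assumes \<nu>: "signed_measure \<nu>" and null: "\<And>B. B \<in> sets borel \<Longrightarrow> B \<inter> measure_support \<mu> = {} \<Longrightarrow> \<nu> B = 0"
  shows "finite_on_support (positive_part \<nu>)"
  unfolding finite_on_support_def
proof (intro conjI finite_measure_positive_part sets_positive_part \<nu>)
  have "closed (measure_support \<mu>)" using supp by (rule compact_imp_closed)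
  then have b: "- (measure_support \<mu>) \<in> sets borel" by auto
  have "emeasure (positive_part \<nu>) (- (measure_support \<mu>)) = (SUP B \<in> {B \<in> sets borel. B \<subseteq> - (measure_support \<mu>)}. ennreal (\<nu> B))"
    by (rule emeasure_positive_part[OF \<nu> b])
  also have "\<dots> \<le> 0" using null by (intro SUP_least) (simp add: disjoint_eq_subset_Compl)
  finally show "AE x in positive_part \<nu>. x \<in> measure_support \<mu>"
    using b by (intro AE_I[of _ _ "- (measure_support \<mu>)"]) (auto simp: sets_positive_part[OF \<nu>])
qed

private lemma parts_finite_on_support:
  "finite_on_support (positive_part (\<lambda>A. Re (\<mu> A)))" "finite_on_support (positive_part (\<lambda>A. - Re (\<mu> A)))"
  "finite_on_support (positive_part (\<lambda>A. Im (\<mu> A)))" "finite_on_support (positive_part (\<lambda>A. - Im (\<mu> A)))"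
  using signed_measure_Re signed_measure_Im
  by (auto intro!: positive_part_finite_on_support signed_measure_uminus simp: vanishes_off_support)

private definition "admissible g \<longleftrightarrow> g \<in> borel_measurable borel \<and> (\<exists>B. \<forall>x\<in>measure_support \<mu>. cmod (g x) \<le> B)"

private lemma admissible_continuous:
  assumes "continuous_on UNIV g"
  shows "admissible g"
proof -
  have "bounded (g ` measure_support \<mu>)"
    using assms supp by (intro compact_imp_bounded compact_continuous_image continuous_on_subset[OF assms]) auto
  then show ?thesis
    using assms by (auto simp: admissible_def bounded_iff intro: borel_measurable_continuous_onI)
qed

private lemma integrable_finite_on_support:
  assumes "finite_on_support M" "admissible g"
  shows "integrable M g"
proof -
  interpret finite_measure M using assms by (simp add: finite_on_support_def)
  obtain B where "\<forall>x\<in>measure_support \<mu>. cmod (g x) \<le> B" using assms by (auto simp: admissible_def)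
  moreover have "g \<in> borel_measurable M" using assms by (simp add: finite_on_support_def admissible_def cong: measurable_cong_sets)
  moreover have "AE x in M. x \<in> measure_support \<mu>" using assms by (simp add: finite_on_support_def)
  ultimately show ?thesis
    by (intro integrable_const_bound[of _ B]) (auto elim!: eventually_mono)
qed

private lemmas integrable_parts = parts_finite_on_support[THEN integrable_finite_on_support]

lemma complex_integral_add_admissible:
  assumes "admissible g" "admissible h"
  shows "complex_integral \<mu> (\<lambda>x. g x + h x) = complex_integral \<mu> g + complex_integral \<mu> h"
  using assms
  by (simp add: complex_integral_def signed_integral_def integrable_parts algebra_simps)

lemma complex_integral_mult_admissible:
  assumes "admissible g"
  shows "complex_integral \<mu> (\<lambda>x. a * g x) = a * complex_integral \<mu> g"
  using assms
  by (simp add: complex_integral_def signed_integral_def integrable_parts algebra_simps)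

private lemma admissible_bounded:
  "g \<in> borel_measurable borel \<Longrightarrow> (\<And>x. x \<in> measure_support \<mu> \<Longrightarrow> cmod (g x) \<le> B) \<Longrightarrow> admissible g"
  unfolding admissible_def by blast

lemma complex_integral_indicator:
  assumes "A \<in> sets borel"
  shows "complex_integral \<mu> (indicator A) = \<mu> A"
proof -
  have *: "integral\<^sup>L M (indicator A) = complex_of_real (measure M A)" if "finite_on_support M" for M
  proof -
    have "integral\<^sup>L M (\<lambda>x. complex_of_real (indicator A x)) = complex_of_real (measure M A)"
      using that assms by (subst integral_complex_of_real) (auto simp: finite_on_support_def sets_eq_imp_space_eq[of M borel])
    then show ?thesis by (simp add: of_real_indicator[abs_def])
  qed
  show ?thesis
    unfolding complex_integral_def signed_integral_def *[OF parts_finite_on_support(1)] *[OF parts_finite_on_support(2)]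
      *[OF parts_finite_on_support(3)] *[OF parts_finite_on_support(4)] of_real_diff[symmetric]
      Jordan_decomposition[OF signed_measure_Re assms] Jordan_decomposition[OF signed_measure_Im assms]
    by (simp add: complex_eq_iff)
qed


private lemma admissible_weighted_indicators:
  fixes A :: "nat \<Rightarrow> 'a set"
  assumes "\<And>i. i < n \<Longrightarrow> A i \<in> sets borel"
  shows "admissible (\<lambda>x. \<Sum>i<n. c i * indicator (A i) x)"
proof (rule admissible_bounded)
  show "(\<lambda>x. \<Sum>i<n. c i * indicator (A i) x) \<in> borel_measurable borel"
    using assms by (intro borel_measurable_sum borel_measurable_times) auto
  show "cmod (\<Sum>i<n. c i * indicator (A i) x) \<le> (\<Sum>i<n. cmod (c i))" for x
    by (intro sum_norm_le) (auto simp: norm_mult indicator_def)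
qed

private lemma complex_integral_weighted_indicators:
  fixes A :: "nat \<Rightarrow> 'a set"
  assumes "\<And>i. i < n \<Longrightarrow> A i \<in> sets borel"
  shows "complex_integral \<mu> (\<lambda>x. \<Sum>i<n. c i * indicator (A i) x) = (\<Sum>i<n. c i * \<mu> (A i))"
  using assms
proof (induction n)
  case 0
  have "admissible (\<lambda>_. 0)" by (rule admissible_continuous) simp
  from complex_integral_mult_admissible[OF this, of 0] show ?case by simp
next
  case (Suc n)
  have n: "A n \<in> sets borel" using Suc by simp
  then have ind: "admissible (indicator (A n))" 
    by (intro admissible_bounded[of _ 1]) (auto simp: indicator_def)
  then have "admissible (\<lambda>x. c n * indicator (A n) x)"
    using n by (intro admissible_bounded[of _ "cmod (c n)"]) (auto simp: indicator_def)
  moreover have "admissible (\<lambda>x. \<Sum>i<n. c i * indicator (A i) x)"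
    using Suc.prems by (intro admissible_weighted_indicators) auto
  ultimately have "complex_integral \<mu> (\<lambda>x. (\<Sum>i<n. c i * indicator (A i) x) + c n * indicator (A n) x)
      = complex_integral \<mu> (\<lambda>x. \<Sum>i<n. c i * indicator (A i) x) + c n * \<mu> (A n)"
    using complex_integral_mult_admissible[OF ind] complex_integral_indicator[OF n]
    by (simp only: complex_integral_add_admissible)
  moreover have "complex_integral \<mu> (\<lambda>x. \<Sum>i<n. c i * indicator (A i) x) = (\<Sum>i<n. c i * \<mu> (A i))"
    using Suc by simp
  ultimately show ?case by (simp only: sum.lessThan_Suc)
qed

text \<open>
  The constant \<open>m\<close> is the sum of the four masses in the Jordan decompositions. It is in general larger than the
  total variation norm, but suffices to control the error of a uniform approximation.
\<close>

private lemma complex_integral_crude_bound: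
  obtains m where "0 \<le> m"
    "\<And>g B. g \<in> borel_measurable borel \<Longrightarrow> (\<And>x. cmod (g x) \<le> B) \<Longrightarrow> cmod (complex_integral \<mu> g) \<le> m * B"
proof -
  let ?M = "\<lambda>\<nu>. measure (positive_part \<nu>) UNIV"
  let ?r = "\<lambda>A. Re (\<mu> A)" and ?i = "\<lambda>A. Im (\<mu> A)"
  let ?m = "(?M ?r + ?M (\<lambda>A. - ?r A)) + (?M ?i + ?M (\<lambda>A. - ?i A))"
  have 1: "cmod (integral\<^sup>L M g) \<le> measure M UNIV * B"
    if M: "finite_on_support M" and g: "g \<in> borel_measurable borel" "\<And>x. cmod (g x) \<le> B" for M g B
  proof -
    interpret finite_measure M using M by (simp add: finite_on_support_def)
    have "space M = UNIV" using M by (simp add: finite_on_support_def sets_eq_imp_space_eq[of M borel])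
    moreover have "integrable M g" using M g by (intro integrable_finite_on_support admissible_bounded[of _ B])
    then have "integral\<^sup>L M (\<lambda>x. cmod (g x)) \<le> integral\<^sup>L M (\<lambda>x. B)"
      using g by (intro integral_mono) auto
    ultimately have "integral\<^sup>L M (\<lambda>x. cmod (g x)) \<le> measure M UNIV * B" by simp
    then show ?thesis by (rule order_trans[OF integral_norm_bound])
  qed
  show thesis
  proof (rule that[of ?m])
    fix g :: "'a \<Rightarrow> complex" and B
    assume g: "g \<in> borel_measurable borel" "\<And>x. cmod (g x) \<le> B"
    note b = parts_finite_on_support[THEN 1, OF g]
    have 2: "cmod (signed_integral ?r g) \<le> (?M ?r + ?M (\<lambda>A. - ?r A)) * B"
      unfolding signed_integral_def distrib_right
      by (rule order_trans[OF norm_triangle_ineq4 add_mono[OF b(1,2)]])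
    have 3: "cmod (\<i> * signed_integral ?i g) \<le> (?M ?i + ?M (\<lambda>A. - ?i A)) * B"
      unfolding signed_integral_def distrib_right norm_mult norm_ii mult_1
      by (rule order_trans[OF norm_triangle_ineq4 add_mono[OF b(3,4)]])
    show "cmod (complex_integral \<mu> g) \<le> ?m * B"
      unfolding complex_integral_def distrib_right[of "?M ?r + ?M (\<lambda>A. - ?r A)"]
      by (rule order_trans[OF norm_triangle_ineq add_mono[OF 2 3]])
  qed simp
qed

text \<open>
  For a simple function with values \<open>c i\<close> on disjoint sets \<open>A i\<close> the integral is the sum of
  \<open>c i * \<mu> (A i)\<close>, which the total variation bounds with the right constant. A bounded measurable
  function is a uniform limit of such functions with no larger bound.
\<close>

private lemma complex_integral_bound_everywhere:
  assumes g: "g \<in> borel_measurable borel" and B: "\<And>x. cmod (g x) \<le> B"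
  shows "cmod (complex_integral \<mu> g) \<le> measure_norm \<mu> * B"
proof -
  obtain m where m: "0 \<le> m"
    "\<And>g B. g \<in> borel_measurable borel \<Longrightarrow> (\<And>x. cmod (g x) \<le> B) \<Longrightarrow> cmod (complex_integral \<mu> g) \<le> m * B"
    using complex_integral_crude_bound by blast
  have approx: "cmod (complex_integral \<mu> g) \<le> measure_norm \<mu> * B + m * e" if e: "e > 0" for e
  proof -
    have "cball 0 B \<subseteq> (\<Union>z\<in>cball (0::complex) B. ball z e)" using e by auto
    then obtain C where C: "C \<subseteq> cball (0::complex) B" "finite C" "cball 0 B \<subseteq> (\<Union>z\<in>C. ball z e)"
      by (meson compact_cball compactE_image open_ball)
    obtain c n where cn: "C = c ` {i::nat. i < n}"
      using finite_imp_nat_seg_image_inj_on[OF C(2)] by blast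
    \<comment> \<open>Taking the first ball that contains \<open>g x\<close> makes the level sets \<open>A i\<close> disjoint.\<close>
    define idx where "idx x = (LEAST i. dist (c i) (g x) < e)" for x
    define A where "A i = {x. idx x = i}" for i
    have A: "A i \<in> sets borel" for i
      using measurable_Least_ball[OF g, of c e i] by (simp add: A_def idx_def)
    have idx: "idx x < n" "dist (c (idx x)) (g x) < e" for x
    proof -
      have "g x \<in> cball 0 B" using B by simp
      then obtain i where i: "i < n" "dist (c i) (g x) < e" using C cn by auto
      show "dist (c (idx x)) (g x) < e" unfolding idx_def by (rule LeastI[of _ i]) (rule i)
      show "idx x < n" using Least_le[of "\<lambda>i. dist (c i) (g x) < e", OF i(2)] i(1)
        unfolding idx_def by linarith
    qed
    define s where "s x = (\<Sum>i<n. c i * indicator (A i) x)" for x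
    have s: "s x = c (idx x)" for x
    proof -
      have "s x = (\<Sum>i<n. if i = idx x then c i else 0)"
        unfolding s_def by (intro sum.cong) (auto simp: A_def indicator_def)
      then show ?thesis using idx(1)[of x] by (simp add: sum.delta)
    qed
    have ad: "admissible s" unfolding s_def by (rule admissible_weighted_indicators) (rule A)
    have sm: "s \<in> borel_measurable borel" using ad by (simp add: admissible_def)
    have "cmod (complex_integral \<mu> s) \<le> (\<Sum>i<n. cmod (\<mu> (A i)) * B)"
      unfolding s_def complex_integral_weighted_indicators[OF A]
    proof (rule sum_norm_le)
      fix i assume "i \<in> {..<n}"
      then have "cmod (c i) \<le> B" using C(1) cn by auto
      then show "cmod (c i * \<mu> (A i)) \<le> cmod (\<mu> (A i)) * B"
        by (simp add: norm_mult mult.commute mult_right_mono)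
    qed
    also have "\<dots> \<le> measure_norm \<mu> * B"
    proof -
      have "0 \<le> B" using B[of undefined] norm_ge_zero order_trans by blast
      moreover have "(\<Sum>i<n. cmod (\<mu> (A i))) \<le> measure_norm \<mu>"
        by (rule sum_cmod_le_measure_norm) (auto simp: A disjoint_family_on_def, simp add: A_def)
      ultimately show ?thesis by (simp add: mult_right_mono flip: sum_distrib_right)
    qed
    finally have 1: "cmod (complex_integral \<mu> s) \<le> measure_norm \<mu> * B" .
    have "cmod (g x - s x) \<le> e" for x
      using idx(2)[of x] s[of x] by (simp add: dist_norm norm_minus_commute less_imp_le)
    then have 2: "cmod (complex_integral \<mu> (\<lambda>x. g x - s x)) \<le> m * e"
      using g sm by (intro m(2)) auto
    have "admissible (\<lambda>x. g x - s x)"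
      using g sm \<open>\<And>x. cmod (g x - s x) \<le> e\<close> by (intro admissible_bounded) auto
    from complex_integral_add_admissible[OF ad this]
    have "complex_integral \<mu> g = complex_integral \<mu> s + complex_integral \<mu> (\<lambda>x. g x - s x)" by simp
    then show ?thesis using 1 2 by (simp add: norm_triangle_mono)
  qed
  show ?thesis
  proof (rule field_le_epsilon)
    fix e :: real assume e: "e > 0"
    have "cmod (complex_integral \<mu> g) \<le> measure_norm \<mu> * B + m * (e / (m + 1))"
      using e m(1) by (intro approx) auto
    also have "m * (e / (m + 1)) \<le> e" using e m(1) by (simp add: field_simps)
    finally show "cmod (complex_integral \<mu> g) \<le> measure_norm \<mu> * B + e" by simp
  qed
qed

lemma complex_integral_add:
  "continuous_on UNIV g \<Longrightarrow> continuous_on UNIV h \<Longrightarrow>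
    complex_integral \<mu> (\<lambda>x. g x + h x) = complex_integral \<mu> g + complex_integral \<mu> h"
  by (intro complex_integral_add_admissible admissible_continuous)

lemma complex_integral_mult:
  "continuous_on UNIV g \<Longrightarrow> complex_integral \<mu> (\<lambda>x. a * g x) = a * complex_integral \<mu> g"
  by (intro complex_integral_mult_admissible admissible_continuous)

text \<open>
  Off the support all four measures vanish, so \<open>g\<close> may be cut off there, which makes it bounded.
\<close>

lemma complex_integral_bound:
  assumes g: "continuous_on UNIV g" and B: "0 \<le> B" "\<And>x. x \<in> measure_support \<mu> \<Longrightarrow> cmod (g x) \<le> B"
  shows "cmod (complex_integral \<mu> g) \<le> measure_norm \<mu> * B"
proof -
  have "closed (measure_support \<mu>)" using supp by (rule compact_imp_closed)
  define h where "h x = indicator (measure_support \<mu>) x * g x" for x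
  have gm: "g \<in> borel_measurable borel" using g by (rule borel_measurable_continuous_onI)
  have hm: "h \<in> borel_measurable borel"
    unfolding h_def using gm \<open>closed (measure_support \<mu>)\<close> by (intro borel_measurable_times) auto
  have "integral\<^sup>L M g = integral\<^sup>L M h" if "finite_on_support M" for M
    using that gm hm unfolding finite_on_support_def
    by (intro integral_cong_AE) (auto simp: h_def cong: measurable_cong_sets elim!: eventually_mono)
  then have "complex_integral \<mu> g = complex_integral \<mu> h"
    using parts_finite_on_support by (simp add: complex_integral_def signed_integral_def)
  moreover have "cmod (h x) \<le> B" for x using B by (auto simp: h_def indicator_def)
  ultimately show ?thesis using complex_integral_bound_everywhere[OF hm] by simp
qed

end

section \<open>Averages over a compact group of automorphisms and antiautomorphisms\<close>

lemma continuous_map_nested_projections: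
  "continuous_map (prod_topology (prod_topology X Y) Z) X (\<lambda>p. fst (fst p))"
  "continuous_map (prod_topology (prod_topology X Y) Z) Y (\<lambda>p. snd (fst p))"
  "continuous_map (prod_topology X (prod_topology Y Z)) Y (\<lambda>p. fst (snd p))"
  "continuous_map (prod_topology X (prod_topology Y Z)) Z (\<lambda>p. snd (snd p))"
  using continuous_map_fst_of[OF continuous_map_fst, of X Y Z] continuous_map_snd_of[OF continuous_map_fst, of X Y Z]
    continuous_map_fst_of[OF continuous_map_snd, of X Y Z] continuous_map_snd_of[OF continuous_map_snd, of X Y Z]
  by (simp_all add: o_def)

lemma continuous_map_identity: "continuous_map X X (\<lambda>x. x)"
  using continuous_map_id[of X] by (simp add: id_def)

lemma continuous_map_constant: "a \<in> topspace Y \<Longrightarrow> continuous_map X Y (\<lambda>x. a)"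
  by simp

lemma continuous_map_group_add:
  fixes u v :: "'b \<Rightarrow> 'a::topological_monoid_add"
  assumes "continuous_map X euclidean u" "continuous_map X euclidean v"
  shows "continuous_map X euclidean (\<lambda>p. u p + v p)"
  using assms unfolding continuous_map_atin limitin_canonical_iff by (auto intro!: tendsto_add)

lemma continuous_map_on_UNIV:
  assumes "continuous_on UNIV f" "continuous_map X euclidean u"
  shows "continuous_map X euclidean (\<lambda>p. f (u p))"
  using continuous_map_compose[OF assms(2), of euclidean f] assms(1) by (simp add: o_def)

abbreviation finv :: "('a \<Rightarrow> 'a) \<Rightarrow> 'a \<Rightarrow> 'a" where
  "finv \<equiv> inv_into UNIV"

text \<open>
  Here \<open>H\<close> stands for integration over \<open>K\<close> and \<open>L\<close> for integration over \<open>G\<close>.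
\<close>

locale invariant_averages =
  fixes K :: "('a::{topological_group_add, t2_space} \<Rightarrow> 'a) set"
    and T :: "('a \<Rightarrow> 'a) topology"
    and H :: "(('a \<Rightarrow> 'a) \<Rightarrow> complex) \<Rightarrow> complex"
    and L :: "('a \<Rightarrow> complex) \<Rightarrow> complex"
    and S :: "'a set" and c :: real
  assumes topspace_T: "topspace T = K"
    and bij: "k \<in> K \<Longrightarrow> bij k"
    and auto_or_anti: "k \<in> K \<Longrightarrow> (\<forall>x y. k (x + y) = k x + k y) \<or> (\<forall>x y. k (x + y) = k y + k x)"
    and comp_continuous: "continuous_map (prod_topology T T) T (\<lambda>(g, h). g \<circ> h)"
    and inv_continuous: "continuous_map T T finv"
    and act_continuous: "continuous_map (prod_topology T euclidean) euclidean (\<lambda>(k, x). k x)"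
    and L: "carried_functional euclidean S c L"
    and H: "carried_functional T K 1 H"
    and H_one: "H (\<lambda>_. 1) = 1"
    and L_invariant: "k \<in> K \<Longrightarrow> continuous_on UNIV u \<Longrightarrow> L (\<lambda>t. u (k t)) = L u"
    and H_left_invariant: "k \<in> K \<Longrightarrow> continuous_map T euclidean g \<Longrightarrow> H (\<lambda>h. g (k \<circ> h)) = H g"
begin

lemma comp_in: "k \<in> K \<Longrightarrow> h \<in> K \<Longrightarrow> k \<circ> h \<in> K"
  using continuous_map_image_subset_topspace[OF comp_continuous] topspace_T by fastforce

lemma inv_in: "k \<in> K \<Longrightarrow> finv k \<in> K"
  using continuous_map_image_subset_topspace[OF inv_continuous] topspace_T by fastforce

lemma inv_apply: "k \<in> K \<Longrightarrow> finv k (k x) = x"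
  by (simp add: bij bij_is_inj)

lemma apply_inv: "k \<in> K \<Longrightarrow> k (finv k x) = x"
  by (simp add: bij bij_is_surj surj_f_inv_f)

lemma continuous_map_act:
  "continuous_map X T \<kappa> \<Longrightarrow> continuous_map X euclidean u \<Longrightarrow> continuous_map X euclidean (\<lambda>p. \<kappa> p (u p))"
  using continuous_map_comp2[OF _ _ act_continuous] .

lemma continuous_map_comp_arg:
  "continuous_map X T \<kappa> \<Longrightarrow> continuous_map X T \<kappa>' \<Longrightarrow> continuous_map X T (\<lambda>p. \<kappa> p \<circ> \<kappa>' p)"
  using continuous_map_comp2[OF _ _ comp_continuous] .

lemma continuous_map_inv_arg:
  "continuous_map X T \<kappa> \<Longrightarrow> continuous_map X T (\<lambda>p. finv (\<kappa> p))"
  using continuous_map_compose[OF _ inv_continuous] by (simp add: o_def)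

text \<open>
  Instances of \<open>continuous_map_act\<close> whose patterns are specific enough for use as introduction
  rules.
\<close>

lemma continuous_map_act_projections:
  "continuous_map T euclidean v \<Longrightarrow> continuous_map T euclidean (\<lambda>k. k (v k))"
  "continuous_map T euclidean v \<Longrightarrow> continuous_map T euclidean (\<lambda>k. finv k (v k))"
  "continuous_map (prod_topology X T) euclidean u \<Longrightarrow>
    continuous_map (prod_topology X T) euclidean (\<lambda>p. snd p (u p))"
  "continuous_map (prod_topology T X) euclidean u' \<Longrightarrow>
    continuous_map (prod_topology T X) euclidean (\<lambda>p. fst p (u' p))"
  "continuous_map (prod_topology (prod_topology X T) Y) euclidean w \<Longrightarrow>
    continuous_map (prod_topology (prod_topology X T) Y) euclidean (\<lambda>p. snd (fst p) (w p))"
  "continuous_map (prod_topology Y (prod_topology X T)) euclidean w' \<Longrightarrow>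
    continuous_map (prod_topology Y (prod_topology X T)) euclidean (\<lambda>p. snd (snd p) (w' p))"
  by (rule continuous_map_act; (rule continuous_map_identity continuous_map_fst continuous_map_snd continuous_map_nested_projections inv_continuous | assumption))+

lemmas continuity = continuous_map_constant continuous_map_identity continuous_map_group_add
  continuous_map_fst continuous_map_snd continuous_map_nested_projections continuous_map_comp_arg continuous_map_inv_arg
  continuous_map_act_projections

lemma H_const: "H (\<lambda>_. a) = a"
  using carried_mult[OF H, of "\<lambda>_. 1" a] H_one by simp

text \<open>
  Both sides arise from the double average of \<open>g(k\<inverse> h)\<close>: integrating over \<open>h\<close> first, left invariance
  removes \<open>k\<inverse>\<close>; integrating over \<open>k\<close> first, the substitution \<open>k \<mapsto> h k\<close> removes \<open>h\<close>.
\<close>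

lemma H_inverse:
  assumes g: "continuous_map T euclidean g"
  shows "H (\<lambda>k. g (finv k)) = H g"
proof -
  have comp: "continuous_map X euclidean (\<lambda>p. g (\<kappa> p))" if "continuous_map X T \<kappa>" for X and \<kappa> :: "'x \<Rightarrow> 'a \<Rightarrow> 'a"
    using continuous_map_compose[OF that g] by (simp add: o_def)
  have F: "continuous_map (prod_topology T T) euclidean (case_prod (\<lambda>k h. g (finv k \<circ> h)))"
    unfolding case_prod_beta' by (intro comp continuity)
  have F': "continuous_map (prod_topology T T) euclidean (case_prod (\<lambda>h k. g (finv k \<circ> h)))"
    unfolding case_prod_beta' by (intro comp continuity)
  have inner: "H (\<lambda>k. g (finv k \<circ> h)) = H (\<lambda>k. g (finv k))" if h: "h \<in> K" for h
  proof -
    have cg: "continuous_map T euclidean (\<lambda>k. g (finv k \<circ> h))"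
      using h topspace_T by (intro comp continuity) auto
    have "H (\<lambda>k. g (finv k \<circ> h)) = H (\<lambda>k. g (finv (h \<circ> k) \<circ> h))"
      using H_left_invariant[OF h cg] by simp
    also have "\<dots> = H (\<lambda>k. g (finv k))"
    proof (rule carried_cong[OF H])
      show "continuous_map T euclidean (\<lambda>k. g (finv (h \<circ> k) \<circ> h))"
        using h topspace_T by (intro comp continuity) auto
      show "continuous_map T euclidean (\<lambda>k. g (finv k))"
        by (intro comp continuity)
      show "g (finv (h \<circ> k) \<circ> h) = g (finv k)" if "k \<in> K" for k
      proof -
        have "finv (h \<circ> k) \<circ> h = finv k"
          using h that by (simp add: o_inv_distrib bij fun_eq_iff inv_apply)
        then show ?thesis by simp
      qed
    qed
    finally show ?thesis .
  qed
  have "H g = H (\<lambda>k. H (\<lambda>h. g (finv k \<circ> h)))"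
  proof -
    have "H (\<lambda>k. H (\<lambda>h. g (finv k \<circ> h))) = H (\<lambda>_. H g)"
      by (rule carried_cong[OF H carried_continuous[OF H F]])
        (auto intro!: H_left_invariant g inv_in)
    then show ?thesis by (simp add: H_const)
  qed
  also have "\<dots> = H (\<lambda>h. H (\<lambda>k. g (finv k \<circ> h)))"
    by (rule carried_Fubini[OF H H F])
  also have "\<dots> = H (\<lambda>h. H (\<lambda>k. g (finv k)))"
    by (rule carried_cong[OF H carried_continuous[OF H F']]) (auto simp: inner)
  finally show ?thesis by (simp add: H_const)
qed

lemma H_right_invariant:
  assumes g: "continuous_map T euclidean g" and m: "m \<in> K"
  shows "H (\<lambda>k. g (k \<circ> m)) = H g"
proof -
  have comp: "continuous_map X euclidean (\<lambda>p. g (\<kappa> p))" if "continuous_map X T \<kappa>" for X and \<kappa> :: "'x \<Rightarrow> 'a \<Rightarrow> 'a"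
    using continuous_map_compose[OF that g] by (simp add: o_def)
  have gi: "continuous_map T euclidean (\<lambda>k. g (finv k))" by (intro comp continuity)
  have gm: "continuous_map T euclidean (\<lambda>k. g (k \<circ> m))"
    using m topspace_T by (intro comp continuity) auto
  have "H (\<lambda>k. g (k \<circ> m)) = H (\<lambda>k. g (finv k \<circ> m))"
    using H_inverse[OF gm] by simp
  also have "\<dots> = H (\<lambda>k. g (finv (finv m \<circ> k)))"
  proof (rule carried_cong[OF H])
    show "continuous_map T euclidean (\<lambda>k. g (finv k \<circ> m))"
      using m topspace_T by (intro comp continuity) auto
    show "continuous_map T euclidean (\<lambda>k. g (finv (finv m \<circ> k)))"
      using inv_in[OF m] topspace_T by (intro comp continuity) auto
    show "g (finv k \<circ> m) = g (finv (finv m \<circ> k))" if "k \<in> K" for k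
      using m that by (simp add: o_inv_distrib bij bij_imp_bij_inv inv_inv_eq)
  qed
  also have "\<dots> = H (\<lambda>k. g (finv k))" by (rule H_left_invariant[OF inv_in[OF m] gi])
  also have "\<dots> = H g" by (rule H_inverse[OF g])
  finally show ?thesis .
qed

definition multiplicative :: "('a \<Rightarrow> 'a) \<Rightarrow> bool" where
  "multiplicative k \<longleftrightarrow> (\<forall>x y. k (x + y) = k x + k y)"

lemma nonmultiplicative_apply: "k \<in> K \<Longrightarrow> \<not> multiplicative k \<Longrightarrow> k (x + y) = k y + k x"
  using auto_or_anti[of k] unfolding multiplicative_def by blast

lemma multiplicative_inv: assumes "k \<in> K" "multiplicative k" shows "multiplicative (finv k)"
  unfolding multiplicative_def
proof (intro allI)
  fix x y
  have "k (finv k x + finv k y) = x + y" using assms by (simp add: multiplicative_def apply_inv)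
  then show "finv k (x + y) = finv k x + finv k y" using inv_apply[OF assms(1)] by metis
qed

text \<open>
  An automorphism in \<open>K\<close> may be anti-multiplicative as well, when \<open>G\<close> is commutative. The parity
  rule survives because the halves are the subgroup of automorphisms and its complement, and a
  product of two antiautomorphisms is an automorphism.
\<close>

lemma multiplicative_comp:
  assumes k: "k \<in> K" and h: "h \<in> K"
  shows "multiplicative (k \<circ> h) \<longleftrightarrow> (multiplicative k \<longleftrightarrow> multiplicative h)"
proof -
  have pp: "multiplicative (k \<circ> h)" if "multiplicative k" "multiplicative h" for k h using that by (simp add: multiplicative_def)
  have 1: "multiplicative h" if "multiplicative k" "multiplicative (k \<circ> h)"
  proof -
    have "multiplicative (finv k \<circ> (k \<circ> h))" by (intro pp multiplicative_inv k that)
    moreover have "finv k \<circ> (k \<circ> h) = h" by (simp add: fun_eq_iff inv_apply[OF k])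
    ultimately show ?thesis by metis
  qed
  have 2: "multiplicative k" if "multiplicative h" "multiplicative (k \<circ> h)"
  proof -
    have "multiplicative ((k \<circ> h) \<circ> finv h)" by (intro pp multiplicative_inv h that)
    moreover have "(k \<circ> h) \<circ> finv h = k" by (simp add: fun_eq_iff apply_inv[OF h])
    ultimately show ?thesis by metis
  qed
  have 3: "multiplicative (k \<circ> h)" if "\<not> multiplicative k" "\<not> multiplicative h"
    using nonmultiplicative_apply[OF k that(1)] nonmultiplicative_apply[OF h that(2)] by (simp add: multiplicative_def[of "k \<circ> h"])
  show ?thesis using pp 1 2 3 by blast
qed

lemma multiplicative_closed: "closedin T {k \<in> topspace T. multiplicative k}"
proof -
  have "closedin T {k \<in> topspace T. k (x + y) = k x + k y}" for x y
  proof (rule closedin_continuous_maps_eq)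
    show "Hausdorff_space (euclidean :: 'a topology)"
      unfolding Hausdorff_space_def by (simp add: disjnt_def, metis hausdorff)
  qed (intro continuity; simp)+
  then have "closedin T (\<Inter>(x, y)\<in>UNIV. {k \<in> topspace T. k (x + y) = k x + k y})"
    by (intro closedin_Inter) auto
  also have "(\<Inter>(x, y)\<in>UNIV. {k \<in> topspace T. k (x + y) = k x + k y}) = {k \<in> topspace T. multiplicative k}"
    by (auto simp: multiplicative_def)
  finally show ?thesis .
qed

text \<open>
  If the second half contains some \<open>m\<close>, translation by \<open>m\<close> exchanges the two halves of \<open>K\<close>, so both are closed.
\<close>

lemma nonmultiplicative_closed: "closedin T {k \<in> topspace T. \<not> multiplicative k}"
proof (cases "\<exists>m\<in>K. \<not> multiplicative m")
  case True
  then obtain m where m: "m \<in> K" "\<not> multiplicative m" by blast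
  have "closedin T {k \<in> topspace T. m \<circ> k \<in> {k \<in> topspace T. multiplicative k}}"
    using m topspace_T by (intro closedin_continuous_map_preimage[OF _ multiplicative_closed] continuity) auto
  also have "{k \<in> topspace T. m \<circ> k \<in> {k \<in> topspace T. multiplicative k}} = {k \<in> topspace T. \<not> multiplicative k}"
    using m by (auto simp: topspace_T comp_in multiplicative_comp)
  finally show ?thesis .
next
  case False
  then have "{k \<in> topspace T. \<not> multiplicative k} = {}" using topspace_T by auto
  then show ?thesis by (simp only: closedin_empty)
qed

definition weight :: "bool \<Rightarrow> ('a \<Rightarrow> 'a) \<Rightarrow> complex" where
  "weight a k = of_bool (multiplicative k = a)"

lemma weight_continuous: "continuous_map T euclidean (weight a)"
  unfolding continuous_map_dist_iff
proof (intro ballI allI impI)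
  fix k and e :: real assume k: "k \<in> topspace T" and e: "e > 0"
  have "topspace T - {k \<in> topspace T. \<not> multiplicative k} = {k \<in> topspace T. multiplicative k}"
    "topspace T - {k \<in> topspace T. multiplicative k} = {k \<in> topspace T. \<not> multiplicative k}" by auto
  then have "openin T {h \<in> topspace T. multiplicative h}" "openin T {h \<in> topspace T. \<not> multiplicative h}"
    using multiplicative_closed nonmultiplicative_closed by (simp_all add: closedin_def)
  then have "openin T {h \<in> topspace T. multiplicative h = multiplicative k}" by (cases "multiplicative k") auto
  then show "\<exists>U. openin T U \<and> k \<in> U \<and> (\<forall>h\<in>U. dist (weight a h) (weight a k) < e)"
    using k e by (intro exI[of _ "{h \<in> topspace T. multiplicative h = multiplicative k}"]) (auto simp: weight_def)
qed

text \<open>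
  Integration over the half of \<open>K\<close> that consists of automorphisms (\<open>a = True\<close>) or of the rest.
\<close>

definition H_part :: "bool \<Rightarrow> (('a \<Rightarrow> 'a) \<Rightarrow> complex) \<Rightarrow> complex" where
  "H_part a g = H (\<lambda>k. weight a k * g k)"

lemma H_part: "carried_functional T K 1 (H_part a)"
  unfolding H_part_def[abs_def] by (rule carried_weight[OF H weight_continuous]) (simp add: weight_def)

lemma H_part_cong:
  assumes "continuous_map T euclidean g" "continuous_map T euclidean g'"
    and "\<And>k. k \<in> K \<Longrightarrow> multiplicative k = a \<Longrightarrow> g k = g' k"
  shows "H_part a g = H_part a g'"
  unfolding H_part_def
  by (intro carried_cong[OF H] continuous_map_mult_complex weight_continuous assms(1,2))
    (use assms(3) in \<open>auto simp: weight_def\<close>)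

lemma H_split:
  assumes g: "continuous_map T euclidean g"
  shows "H g = H_part True g + H_part False g"
proof -
  have "H (\<lambda>k. weight True k * g k + weight False k * g k) = H_part True g + H_part False g"
    unfolding H_part_def by (intro carried_add[OF H] continuous_map_mult_complex weight_continuous g)
  moreover have "weight True k * g k + weight False k * g k = g k" for k by (simp add: weight_def)
  ultimately show ?thesis by simp
qed

lemma H_part_inverse:
  assumes g: "continuous_map T euclidean g"
  shows "H_part a (\<lambda>k. g (finv k)) = H_part a g"
proof -
  have gi: "continuous_map T euclidean (\<lambda>k. g (finv k))"
    using continuous_map_compose[OF inv_continuous g] by (simp add: o_def)
  have weight_i: "continuous_map T euclidean (\<lambda>k. weight a (finv k))"
    using continuous_map_compose[OF inv_continuous weight_continuous] by (simp add: o_def)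
  have multiplicative: "multiplicative (finv k) = multiplicative k" if "k \<in> K" for k
    using multiplicative_inv[OF that] multiplicative_inv[OF inv_in[OF that]] bij[OF that] by (auto simp: inv_inv_eq)
  have "H_part a (\<lambda>k. g (finv k)) = H (\<lambda>k. weight a (finv k) * g (finv k))"
    unfolding H_part_def
    by (intro carried_cong[OF H] continuous_map_mult_complex weight_continuous gi weight_i) (auto simp: weight_def multiplicative)
  also have "\<dots> = H_part a g"
    unfolding H_part_def by (intro H_inverse[of "\<lambda>k. weight a k * g k"] continuous_map_mult_complex weight_continuous g)
  finally show ?thesis .
qed

lemma H_part_translate:
  assumes g: "continuous_map T euclidean g" and h: "h \<in> K"
  shows "H_part a (\<lambda>k. g (h \<circ> k)) = H_part (multiplicative h = a) g"
proof -
  have hk: "continuous_map T T (\<lambda>k. h \<circ> k)"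
    using h topspace_T by (intro continuity) auto
  have gh: "continuous_map T euclidean (\<lambda>k. g (h \<circ> k))"
    and weight_h: "continuous_map T euclidean (\<lambda>k. weight (multiplicative h = a) (h \<circ> k))"
    using continuous_map_compose[OF hk g] continuous_map_compose[OF hk weight_continuous] by (simp_all add: o_def)
  have "H_part a (\<lambda>k. g (h \<circ> k)) = H (\<lambda>k. weight (multiplicative h = a) (h \<circ> k) * g (h \<circ> k))"
    unfolding H_part_def
    by (intro carried_cong[OF H] continuous_map_mult_complex weight_continuous gh weight_h) (auto simp: weight_def multiplicative_comp h)
  also have "\<dots> = H_part (multiplicative h = a) g"
    unfolding H_part_def
    by (intro H_left_invariant[of h "\<lambda>k. weight (multiplicative h = a) k * g k"] continuous_map_mult_complex weight_continuous g h)
  finally show ?thesis .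
qed

text \<open>
  Integration over \<open>G \<times> K\<close>, restricted to one half of \<open>K\<close>, as a single functional: one application
  of \<open>carried_Fubini\<close> then interchanges two pairs of integrals.
\<close>

definition pair_integral :: "bool \<Rightarrow> ('a \<times> ('a \<Rightarrow> 'a) \<Rightarrow> complex) \<Rightarrow> complex" where
  "pair_integral a g = L (\<lambda>t. H_part a (\<lambda>k. g (t, k)))"

lemma pair_integral: "carried_functional (prod_topology euclidean T) (S \<times> K) c (pair_integral a)"
  using carried_prod[OF L H_part] unfolding pair_integral_def[abs_def] by simp

end

section \<open>The approximate product formula\<close>

locale product_formula_defect = invariant_averages +
  fixes f :: "'a \<Rightarrow> complex" and \<delta> :: real
  assumes f_continuous: "continuous_on UNIV f"
    and \<delta>: "\<delta> > 0"
    and defect: "norm (L (\<lambda>t. H (\<lambda>k. f (x + t + k y))) - f x * f y) \<le> \<delta>"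
begin

lemmas f_cont = continuous_map_on_UNIV[OF f_continuous]

text \<open>
  The supremum \<open>M\<close> of \<open>|f|\<close> satisfies \<open>M\<^sup>2 \<le> \<delta> + c M\<close>; the bound is the larger root of that quadratic.
\<close>

lemma bounded_case:
  assumes "bounded (range f)"
  shows "norm (f x) \<le> (c + sqrt (c\<^sup>2 + 4 * \<delta>)) / 2"
proof -
  define M where "M = (SUP x. norm (f x))"
  have bdd: "bdd_above (range (\<lambda>x. norm (f x)))"
    using assms by (auto simp: bounded_iff bdd_above_def)
  have fM: "norm (f x) \<le> M" for x
    unfolding M_def by (rule cSUP_upper[OF _ bdd]) simp
  then have M0: "0 \<le> M" using norm_ge_zero order_trans by blast
  have avg: "norm (L (\<lambda>t. H (\<lambda>k. f (x + t + k x)))) \<le> c * M" for x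
  proof (rule carried_bound[OF L _ M0])
    show "continuous_map euclidean euclidean (\<lambda>t. H (\<lambda>k. f (x + t + k x)))"
      by (rule carried_continuous[OF H]) (unfold case_prod_beta', intro f_cont continuity; simp)
    show "norm (H (\<lambda>k. f (x + t + k x))) \<le> M" for t
      using carried_bound[OF H _ M0, of "\<lambda>k. f (x + t + k x)"] fM by (simp add: f_cont continuity)
  qed
  have "(norm (f x))\<^sup>2 \<le> \<delta> + c * M" for x
  proof -
    have "norm (f x * f x) \<le> norm (L (\<lambda>t. H (\<lambda>k. f (x + t + k x)))) + \<delta>"
      using defect[of x x] norm_triangle_sub[of "f x * f x" "L (\<lambda>t. H (\<lambda>k. f (x + t + k x)))"]
      by (simp add: norm_minus_commute)
    then show ?thesis using avg[of x] by (simp add: norm_mult power2_eq_square)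
  qed
  then have "norm (f x) \<le> sqrt (\<delta> + c * M)" for x by (simp add: real_le_rsqrt)
  then have "M \<le> sqrt (\<delta> + c * M)" unfolding M_def by (intro cSUP_least) auto
  then have "M\<^sup>2 \<le> \<delta> + c * M"
    using M0 \<delta> carried_nonneg[OF L] by (metis add_nonneg_nonneg less_imp_le mult_nonneg_nonneg real_sqrt_ge_0_iff real_sqrt_pow2 power_mono)
  then have "(2 * M - c)\<^sup>2 \<le> c\<^sup>2 + 4 * \<delta>" by (simp add: power2_eq_square algebra_simps)
  then have "2 * M - c \<le> sqrt (c\<^sup>2 + 4 * \<delta>)" by (rule real_le_rsqrt)
  then show ?thesis using fM[of x] by simp
qed

text \<open>
  The average \<open>A\<^sup>+\<close> for \<open>a = True\<close> and \<open>A\<^sup>-\<close> for \<open>a = False\<close>.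
\<close>

definition average :: "bool \<Rightarrow> 'a \<Rightarrow> 'a \<Rightarrow> complex" where
  "average a x y = L (\<lambda>t. H_part a (\<lambda>k. f (x + t + k y)))"

lemma average_eq_pair_integral: "average a x y = pair_integral a (\<lambda>p. f (x + fst p + snd p y))"
  by (simp add: average_def pair_integral_def)

lemma average_continuous:
  assumes "continuous_map X euclidean u" "continuous_map X euclidean v"
  shows "continuous_map X euclidean (\<lambda>p. average a (u p) (v p))"
proof -
  have u: "continuous_map (prod_topology X Y) euclidean (\<lambda>p. u (fst p))" for Y :: "'q topology"
    using continuous_map_compose[OF continuous_map_fst assms(1)] by (simp add: o_def)
  have v: "continuous_map (prod_topology X Y) euclidean (\<lambda>p. v (fst p))" for Y :: "'q topology"
    using continuous_map_compose[OF continuous_map_fst assms(2)] by (simp add: o_def)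
  show ?thesis
    unfolding average_eq_pair_integral
    by (rule carried_continuous[OF pair_integral]) (unfold case_prod_beta', intro f_cont continuity u v)
qed

lemma average_split: "L (\<lambda>t. H (\<lambda>k. f (x + t + k y))) = average True x y + average False x y"
proof -
  have "H (\<lambda>k. f (x + t + k y)) = H_part True (\<lambda>k. f (x + t + k y)) + H_part False (\<lambda>k. f (x + t + k y))" for t
    by (intro H_split f_cont continuity; simp)
  moreover have "continuous_map euclidean euclidean (\<lambda>t. H_part a (\<lambda>k. f (x + t + k y)))" for a
    by (rule carried_continuous[OF H_part]) (unfold case_prod_beta', intro f_cont continuity; simp)
  ultimately show ?thesis unfolding average_def by (simp add: carried_add[OF L])
qed

lemma defect_average: "norm (average True x y + average False x y - f x * f y) \<le> \<delta>"
  using defect[of x y] by (simp add: average_split)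

text \<open>
  Schematically the average of \<open>f(x t (k\<cdot>y) s (h\<cdot>z))\<close> over \<open>s, t \<in> G\<close>, with \<open>k\<close> in the half \<open>a\<close> and
  \<open>h\<close> in the half \<open>b\<close> of \<open>K\<close>.
\<close>

definition double_average :: "bool \<Rightarrow> bool \<Rightarrow> 'a \<Rightarrow> 'a \<Rightarrow> 'a \<Rightarrow> complex" where
  "double_average a b x y z = L (\<lambda>t. H_part a (\<lambda>k. average b (x + t + k y) z))"

lemma double_average_eq_pair_integral: "double_average a b x y z = pair_integral a (\<lambda>p. average b (x + fst p + snd p y) z)"
  by (simp add: double_average_def pair_integral_def)

lemma nested_Fubini:
  assumes "continuous_map (prod_topology (prod_topology euclidean T) (prod_topology euclidean T)) euclidean
     (\<lambda>p. \<Phi> (fst (fst p)) (snd (fst p)) (fst (snd p)) (snd (snd p)))"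
  shows "L (\<lambda>t. H_part a (\<lambda>k. L (\<lambda>s. H_part b (\<lambda>h. \<Phi> t k s h)))) = L (\<lambda>s. H_part b (\<lambda>h. L (\<lambda>t. H_part a (\<lambda>k. \<Phi> t k s h))))"
  using carried_Fubini[OF pair_integral[of a] pair_integral[of b], of "\<lambda>p q. \<Phi> (fst p) (snd p) (fst q) (snd q)"] assms
  by (simp add: pair_integral_def case_prod_beta')

lemma translated_average_continuous:
  "continuous_map T euclidean (\<lambda>h. L (\<lambda>t. H_part a (\<lambda>k. f (z + s + h (x + t + k y)))))"
proof -
  have "continuous_map T euclidean (\<lambda>h. pair_integral a (\<lambda>p. f (z + s + h (x + fst p + snd p y))))"
    by (rule carried_continuous[OF pair_integral]) (unfold case_prod_beta', intro f_cont continuity; simp)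
  then show ?thesis by (simp add: pair_integral_def)
qed

text \<open>
  For an automorphism \<open>h\<close>, \<open>h\<cdot>(x t (k\<cdot>y)) = (h\<cdot>x) (h\<cdot>t) (hk\<cdot>y)\<close>; invariance replaces \<open>h\<cdot>t\<close> by \<open>t\<close> and
  \<open>hk\<close> by \<open>k\<close>, once the integral over \<open>h\<close> has been moved outside.
\<close>

lemma average_distrib_True:
  "L (\<lambda>t. H_part a (\<lambda>k. average True z (x + t + k y))) = double_average True a z x y"
proof -
  have "L (\<lambda>t. H_part a (\<lambda>k. average True z (x + t + k y)))
      = L (\<lambda>s. H_part True (\<lambda>h. L (\<lambda>t. H_part a (\<lambda>k. f (z + s + h (x + t + k y))))))"
    unfolding average_def by (rule nested_Fubini) (intro f_cont continuity; simp)
  also have "\<dots> = L (\<lambda>s. H_part True (\<lambda>h. average a (z + s + h x) y))"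
  proof (rule arg_cong[of _ _ L], rule ext, rule H_part_cong)
    fix s
    show "continuous_map T euclidean (\<lambda>h. L (\<lambda>t. H_part a (\<lambda>k. f (z + s + h (x + t + k y)))))"
      by (rule translated_average_continuous)
    show "continuous_map T euclidean (\<lambda>h. average a (z + s + h x) y)"
      by (intro average_continuous continuity; simp)
    fix h assume h: "h \<in> K" "multiplicative h = True"
    have "L (\<lambda>t. H_part a (\<lambda>k. f (z + s + h (x + t + k y))))
        = L (\<lambda>t. H_part a (\<lambda>k. f (z + s + (h x + h t + (h \<circ> k) y))))"
      using h by (simp add: multiplicative_def)
    also have "\<dots> = L (\<lambda>t. H_part a (\<lambda>k. f (z + s + (h x + h t + k y))))"
    proof (intro arg_cong[of _ _ L] ext)
      fix t
      show "H_part a (\<lambda>k. f (z + s + (h x + h t + (h \<circ> k) y))) = H_part a (\<lambda>k. f (z + s + (h x + h t + k y)))"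
        using H_part_translate[of "\<lambda>k. f (z + s + (h x + h t + k y))" h a] h
        by (simp add: f_cont continuity)
    qed
    also have "\<dots> = L (\<lambda>t. H_part a (\<lambda>k. f (z + s + (h x + t + k y))))"
    proof (rule L_invariant[OF h(1), of "\<lambda>t. H_part a (\<lambda>k. f (z + s + (h x + t + k y)))"])
      have "continuous_map euclidean euclidean (\<lambda>t. H_part a (\<lambda>k. f (z + s + (h x + t + k y))))"
        by (rule carried_continuous[OF H_part]) (unfold case_prod_beta', intro f_cont continuity; simp)
      then show "continuous_on UNIV (\<lambda>t. H_part a (\<lambda>k. f (z + s + (h x + t + k y))))" by simp
    qed
    finally show "L (\<lambda>t. H_part a (\<lambda>k. f (z + s + h (x + t + k y)))) = average a (z + s + h x) y"
      by (simp add: average_def add.assoc)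
  qed
  finally show ?thesis by (simp add: double_average_def)
qed

text \<open>
  For an antiautomorphism \<open>h\<close>, \<open>h\<cdot>(x t (k\<cdot>y)) = (hk\<cdot>y) (h\<cdot>t) (h\<cdot>x)\<close>: the factors \<open>x\<close> and \<open>y\<close> trade
  places, and \<open>hk\<close> runs through the other half of \<open>K\<close> than \<open>k\<close>.
\<close>

lemma average_distrib_False:
  "L (\<lambda>t. H_part a (\<lambda>k. average False z (x + t + k y))) = double_average (\<not> a) False z y x"
proof -
  let ?B = "\<lambda>s h. L (\<lambda>t. H_part (\<not> a) (\<lambda>k. f (z + s + (k y + t + h x))))"
  have "L (\<lambda>t. H_part a (\<lambda>k. average False z (x + t + k y)))
      = L (\<lambda>s. H_part False (\<lambda>h. L (\<lambda>t. H_part a (\<lambda>k. f (z + s + h (x + t + k y))))))"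
    unfolding average_def by (rule nested_Fubini) (intro f_cont continuity; simp)
  also have "\<dots> = L (\<lambda>s. H_part False (?B s))"
  proof (rule arg_cong[of _ _ L], rule ext, rule H_part_cong)
    fix s
    show "continuous_map T euclidean (\<lambda>h. L (\<lambda>t. H_part a (\<lambda>k. f (z + s + h (x + t + k y)))))"
      by (rule translated_average_continuous)
    have "continuous_map T euclidean (\<lambda>h. pair_integral (\<not> a) (\<lambda>p. f (z + s + (snd p y + fst p + h x))))"
      by (rule carried_continuous[OF pair_integral]) (unfold case_prod_beta', intro f_cont continuity; simp)
    then show "continuous_map T euclidean (?B s)" by (simp add: pair_integral_def)
    fix h assume h: "h \<in> K" "multiplicative h = False"
    have "L (\<lambda>t. H_part a (\<lambda>k. f (z + s + h (x + t + k y))))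
        = L (\<lambda>t. H_part a (\<lambda>k. f (z + s + ((h \<circ> k) y + h t + h x))))"
      using h by (simp add: nonmultiplicative_apply add.assoc)
    also have "\<dots> = L (\<lambda>t. H_part (\<not> a) (\<lambda>k. f (z + s + (k y + h t + h x))))"
    proof (intro arg_cong[of _ _ L] ext)
      fix t
      show "H_part a (\<lambda>k. f (z + s + ((h \<circ> k) y + h t + h x))) = H_part (\<not> a) (\<lambda>k. f (z + s + (k y + h t + h x)))"
        using H_part_translate[of "\<lambda>k. f (z + s + (k y + h t + h x))" h a] h
        by (simp add: f_cont continuity)
    qed
    also have "\<dots> = ?B s h"
    proof (rule L_invariant[OF h(1), of "\<lambda>t. H_part (\<not> a) (\<lambda>k. f (z + s + (k y + t + h x)))"])
      have "continuous_map euclidean euclidean (\<lambda>t. H_part (\<not> a) (\<lambda>k. f (z + s + (k y + t + h x))))"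
        by (rule carried_continuous[OF H_part]) (unfold case_prod_beta', intro f_cont continuity; simp)
      then show "continuous_on UNIV (\<lambda>t. H_part (\<not> a) (\<lambda>k. f (z + s + (k y + t + h x))))" by simp
    qed
    finally show "L (\<lambda>t. H_part a (\<lambda>k. f (z + s + h (x + t + k y)))) = ?B s h" .
  qed
  also have "\<dots> = L (\<lambda>s. H_part (\<not> a) (\<lambda>k. average False (z + s + k y) x))"
  proof (intro arg_cong[of _ _ L] ext)
    fix s
    have "H_part False (?B s) = L (\<lambda>t. H_part (\<not> a) (\<lambda>k. H_part False (\<lambda>h. f (z + s + (k y + t + h x)))))"
    proof -
      have "H_part False (\<lambda>h. pair_integral (\<not> a) (\<lambda>p. f (z + s + (snd p y + fst p + h x))))
          = pair_integral (\<not> a) (\<lambda>p. H_part False (\<lambda>h. f (z + s + (snd p y + fst p + h x))))"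
        by (rule carried_Fubini[OF H_part pair_integral]) (unfold case_prod_beta', intro f_cont continuity; simp)
      then show ?thesis by (simp add: pair_integral_def)
    qed
    also have "\<dots> = H_part (\<not> a) (\<lambda>k. L (\<lambda>t. H_part False (\<lambda>h. f (z + s + (k y + t + h x)))))"
    proof (rule carried_Fubini[OF L H_part])
      show "continuous_map (prod_topology euclidean T) euclidean
          (\<lambda>(t, k). H_part False (\<lambda>h. f (z + s + (k y + t + h x))))"
        unfolding case_prod_beta'
        by (rule carried_continuous[OF H_part]) (unfold case_prod_beta', intro f_cont continuity; simp)
    qed
    finally show "H_part False (?B s) = H_part (\<not> a) (\<lambda>k. average False (z + s + k y) x)"
      by (simp add: average_def add.assoc)
  qed
  finally show ?thesis by (simp add: double_average_def)
qed

definition total_average :: "'a \<Rightarrow> 'a \<Rightarrow> 'a \<Rightarrow> complex" where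
  "total_average x y z = double_average True True x y z + double_average True False x y z
     + double_average False True x y z + double_average False False x y z"

text \<open>
  Integrates the hypothesis on \<open>f\<close> at the arguments \<open>x t (k\<cdot>y)\<close> and \<open>z\<close> over \<open>t\<close> and \<open>k\<close>.
\<close>

lemma total_average_near: "norm (total_average x y z - (average True x y + average False x y) * f z) \<le> 2 * c * \<delta>"
proof -
  have cA: "continuous_map (prod_topology euclidean T) euclidean (\<lambda>p. average b (x + fst p + snd p y) z)" for b
    by (intro average_continuous continuity; simp)
  have cf: "continuous_map (prod_topology euclidean T) euclidean (\<lambda>p. f (x + fst p + snd p y))"
    by (intro f_cont continuity; simp)
  have *: "norm (double_average a True x y z + double_average a False x y z - average a x y * f z) \<le> c * \<delta>" for a
  proof -
    have "double_average a True x y z + double_average a False x y z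
        = pair_integral a (\<lambda>p. average True (x + fst p + snd p y) z + average False (x + fst p + snd p y) z)"
      unfolding double_average_eq_pair_integral by (rule carried_add[OF pair_integral cA cA, symmetric])
    moreover have "average a x y * f z = pair_integral a (\<lambda>p. f z * f (x + fst p + snd p y))"
      unfolding average_eq_pair_integral carried_mult[OF pair_integral cf] by simp
    moreover have "norm (pair_integral a (\<lambda>p. average True (x + fst p + snd p y) z + average False (x + fst p + snd p y) z)
        - pair_integral a (\<lambda>p. f z * f (x + fst p + snd p y))) \<le> c * \<delta>"
      using defect_average[of _ z] \<delta>
      by (intro carried_diff_bound[OF pair_integral] continuous_map_add continuous_map_mult_complex cA cf)
         (auto simp: mult.commute[of "f z"])
    ultimately show ?thesis by simp
  qed
  have "total_average x y z - (average True x y + average False x y) * f z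
      = (double_average True True x y z + double_average True False x y z - average True x y * f z)
      + (double_average False True x y z + double_average False False x y z - average False x y * f z)"
    by (simp add: total_average_def algebra_simps)
  then show ?thesis
    using norm_triangle_mono[OF *[of True] *[of False]] by (simp add: mult_ac)
qed

lemma total_average_near_product: "norm (total_average x y z - f x * f y * f z) \<le> 2 * c * \<delta> + \<delta> * norm (f z)"
proof -
  have "norm ((average True x y + average False x y - f x * f y) * f z) \<le> \<delta> * norm (f z)"
    using defect_average[of x y] by (simp add: norm_mult mult_right_mono)
  from norm_triangle_mono[OF total_average_near[of x y z] this] show ?thesis
    by (simp add: algebra_simps)
qed

lemma near_commute:
  assumes "average False x y = average False y x"
  shows "norm (average True x y - average True y x) \<le> 2 * \<delta>"
  using norm_triangle_le_diff[OF add_mono[OF defect_average[of x y] defect_average[of y x]]] assms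
  by (simp add: algebra_simps)

context
  assumes unbounded: "\<not> bounded (range f)"
begin

text \<open>
  Right invariance gives \<open>f(m\<cdot>y)\<close> and \<open>f(y)\<close> the same average in the hypothesis, so
  \<open>|f(x)| |f(m\<cdot>y) - f(y)| \<le> 2 \<delta>\<close> for all \<open>x\<close>, which an unbounded \<open>f\<close> permits only if the
  difference vanishes.
\<close>

lemma f_invariant:
  assumes m: "m \<in> K"
  shows "f (m y) = f y"
proof (rule ccontr)
  assume ne: "f (m y) \<noteq> f y"
  let ?d = "norm (f (m y) - f y)"
  have "norm (f x) \<le> 2 * \<delta> / ?d" for x
  proof -
    have "H (\<lambda>k. f (x + t + k (m y))) = H (\<lambda>k. f (x + t + k y))" for t
      using H_right_invariant[of "\<lambda>k. f (x + t + k y)" m] m by (simp add: f_cont continuity)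
    then have "norm (L (\<lambda>t. H (\<lambda>k. f (x + t + k y))) - f x * f (m y)) \<le> \<delta>"
      using defect[of x "m y"] by simp
    from norm_triangle_le_diff[OF add_mono[OF this defect[of x y]]]
    have "norm (f x * (f y - f (m y))) \<le> 2 * \<delta>" by (simp add: algebra_simps)
    then have "norm (f x) * ?d \<le> 2 * \<delta>" by (simp add: norm_mult norm_minus_commute)
    then show ?thesis using ne by (simp add: pos_le_divide_eq)
  qed
  then have "bounded (range f)" by (auto simp: bounded_iff)
  with unbounded show False by simp
qed

text \<open>
  Apply \<open>k\<inverse>\<close> inside the invariant function: \<open>f(u t (k\<cdot>v)) = f(v (k\<inverse>\<cdot>t) (k\<inverse>\<cdot>u))\<close>. Invariance of
  \<open>L\<close> and inversion invariance of \<open>H\<close> remove the inverses.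
\<close>

lemma average_False_commute: "average False u v = average False v u"
proof -
  have swap: "average False u v = H_part False (\<lambda>k. L (\<lambda>t. f (u + t + k v)))" for u v
    unfolding average_def
    by (rule carried_Fubini[OF L H_part]) (unfold case_prod_beta', intro f_cont continuity; simp)
  have cont: "continuous_map T euclidean (\<lambda>k. L (\<lambda>t. f (u + t + k v)))" for u v
    by (rule carried_continuous[OF L]) (unfold case_prod_beta', intro f_cont continuity; simp)
  have cont': "continuous_map T euclidean (\<lambda>k. L (\<lambda>t. f (u + t + finv k v)))" for u v
    using continuous_map_compose[OF inv_continuous cont] by (simp add: o_def)
  have "H_part False (\<lambda>k. L (\<lambda>t. f (u + t + k v))) = H_part False (\<lambda>k. L (\<lambda>t. f (v + t + finv k u)))"
  proof (rule H_part_cong[OF cont cont'])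
    fix k assume k: "k \<in> K" "multiplicative k = False"
    have nk: "\<not> multiplicative (finv k)" using multiplicative_inv[OF inv_in[OF k(1)]] k by (auto simp: inv_inv_eq bij)
    have "f (u + t + k v) = f (v + finv k t + finv k u)" for t
    proof -
      have "f (u + t + k v) = f (finv k (u + t + k v))" using f_invariant[OF inv_in[OF k(1)]] by simp
      also have "finv k (u + t + k v) = v + (finv k t + finv k u)"
        using nonmultiplicative_apply[OF inv_in[OF k(1)] nk] by (simp add: inv_apply k)
      finally show ?thesis by (simp add: add.assoc)
    qed
    then have "L (\<lambda>t. f (u + t + k v)) = L (\<lambda>t. f (v + finv k t + finv k u))" by simp
    also have "\<dots> = L (\<lambda>t. f (v + t + finv k u))"
    proof (rule L_invariant[OF inv_in[OF k(1)], of "\<lambda>t. f (v + t + finv k u)"])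
      have "continuous_map euclidean euclidean (\<lambda>t. f (v + t + finv k u))"
        by (intro f_cont continuity; simp)
      then show "continuous_on UNIV (\<lambda>t. f (v + t + finv k u))" by simp
    qed
    finally show "L (\<lambda>t. f (u + t + k v)) = L (\<lambda>t. f (v + t + finv k u))" .
  qed
  also have "\<dots> = H_part False (\<lambda>k. L (\<lambda>t. f (v + t + k u)))"
    by (rule H_part_inverse[OF cont])
  finally show ?thesis by (simp add: swap)
qed

text \<open>
  Symmetry of the inner average moves \<open>z\<close> to the front, and the product with \<open>x\<close> and \<open>y\<close> is then reversed.
\<close>

lemma double_average_False: "double_average a False x y z = double_average (\<not> a) False z y x"
  unfolding average_distrib_False[symmetric] by (simp add: double_average_def average_False_commute)

text \<open>
  Moving \<open>z\<close> to the front changes the inner average by at most \<open>2 \<delta>\<close>, and the product with \<open>x\<close> and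
  \<open>y\<close> is then expanded in order.
\<close>

lemma double_average_True: "norm (double_average a True x y z - double_average True a z x y) \<le> 2 * c * \<delta>"
proof -
  have c1: "continuous_map (prod_topology euclidean T) euclidean (\<lambda>p. average True (x + fst p + snd p y) z)"
    by (intro average_continuous continuity; simp)
  have c2: "continuous_map (prod_topology euclidean T) euclidean (\<lambda>p. average True z (x + fst p + snd p y))"
    by (intro average_continuous continuity; simp)
  have "double_average True a z x y = pair_integral a (\<lambda>p. average True z (x + fst p + snd p y))"
    unfolding average_distrib_True[symmetric] by (simp add: pair_integral_def)
  moreover have "norm (pair_integral a (\<lambda>p. average True (x + fst p + snd p y) z)
      - pair_integral a (\<lambda>p. average True z (x + fst p + snd p y))) \<le> c * (2 * \<delta>)"
    using \<delta> by (intro carried_diff_bound[OF pair_integral c1 c2] near_commute average_False_commute) auto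
  ultimately show ?thesis unfolding double_average_eq_pair_integral by (simp add: mult_ac)
qed

text \<open>
  By the two preceding lemmas every part of \<open>total_average\<close> is, exactly or up to \<open>2 c \<delta>\<close>, a part with
  both signs equal at permuted arguments. Of the twelve parts on the right-hand side, eight cancel and
  four are those of \<open>total_average x y z\<close>; six of the replacements are inexact.
\<close>

lemma total_average_relation:
  "norm (total_average x y z - (total_average z y x - total_average x z y + total_average z x y)) \<le> 12 * c * \<delta>"
proof -
  \<comment> \<open>The error of replacing a part with multiplicative inner average by its rotation.\<close>
  define r where "r a x y z = double_average a True x y z - double_average True a z x y" for a x y z
  have r: "norm (r a x y z) \<le> 2 * c * \<delta>" for a x y z unfolding r_def by (rule double_average_True)
  have "total_average x y z - (total_average z y x - total_average x z y + total_average z x y)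
      = r False x y z - r False z y x + (r False x z y - r False z x y) + (r True x y z - r True z y x)"
    unfolding total_average_def r_def
    using double_average_False[of True x y z] double_average_False[of True z y x] double_average_False[of True x z y] double_average_False[of True z x y]
      double_average_False[of True y x z] double_average_False[of True y z x]
    by simp
  moreover have "norm (r False x y z - r False z y x + (r False x z y - r False z x y) + (r True x y z - r True z y x))
     \<le> (2*c*\<delta> + 2*c*\<delta>) + (2*c*\<delta> + 2*c*\<delta>) + (2*c*\<delta> + 2*c*\<delta>)"
    by (intro norm_triangle_mono order_trans[OF norm_triangle_ineq4] add_mono r)
  ultimately show ?thesis by (simp add: mult_ac)
qed

lemma product_formula: "L (\<lambda>t. H (\<lambda>k. f (x + t + k y))) = f x * f y"
proof (rule ccontr)
  assume "\<not> ?thesis"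
  then have ne: "average True x y + average False x y - f x * f y \<noteq> 0" by (simp add: average_split)
  let ?E = "average True x y + average False x y - f x * f y"
  define C where "C = 20 * c * \<delta> + \<delta> * norm (f x) + 2 * \<delta> * norm (f y)"
  have "norm (f z) \<le> C / norm ?E" for z
  proof -
    let ?P = "f x * f y * f z"
    have p: "norm (total_average z y x - ?P) \<le> 2 * c * \<delta> + \<delta> * norm (f x)"
      "norm (total_average x z y - ?P) \<le> 2 * c * \<delta> + \<delta> * norm (f y)"
      "norm (total_average z x y - ?P) \<le> 2 * c * \<delta> + \<delta> * norm (f y)"
      using total_average_near_product[of z y x] total_average_near_product[of x z y] total_average_near_product[of z x y]
      by (simp_all add: mult_ac)
    have "?E * f z = - (total_average x y z - (average True x y + average False x y) * f z)
        + (total_average x y z - (total_average z y x - total_average x z y + total_average z x y))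
        + ((total_average z y x - ?P) - (total_average x z y - ?P) + (total_average z x y - ?P))"
      by (simp add: algebra_simps)
    also have "norm \<dots> \<le> 2 * c * \<delta> + 12 * c * \<delta> + ((2 * c * \<delta> + \<delta> * norm (f x))
       + (2 * c * \<delta> + \<delta> * norm (f y)) + (2 * c * \<delta> + \<delta> * norm (f y)))"
      by (intro norm_triangle_mono order_trans[OF norm_triangle_ineq4] add_mono p total_average_relation)
         (simp add: total_average_near norm_minus_commute)
    finally have "norm (f z) * norm ?E \<le> C" by (simp add: C_def norm_mult mult_ac)
    then show ?thesis using ne by (simp add: pos_le_divide_eq)
  qed
  then have "bounded (range f)" by (auto simp: bounded_iff)
  with unbounded show False by simp
qed

end

end

section \<open>Haar measures and complex measures as carried functionals\<close>

lemma borel_measurable_continuous_map: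
  fixes g :: "'b \<Rightarrow> complex"
  assumes "space M = topspace T" "sets M = borel_sets_of T" "continuous_map T euclidean g"
  shows "g \<in> borel_measurable M"
proof (rule borel_measurableI)
  fix U :: "complex set" assume "open U"
  then have "openin T {x \<in> topspace T. g x \<in> U}"
    using openin_continuous_map_preimage[OF assms(3)] by simp
  moreover have "{x \<in> topspace T. g x \<in> U} = g -` U \<inter> space M" using assms(1) by auto
  ultimately show "g -` U \<inter> space M \<in> sets M"
    unfolding assms(2) borel_sets_of_def by (intro sigma_sets.Basic) simp
qed

lemma integral_carried_functional:
  assumes M: "finite_measure M" "space M = topspace T" "sets M = borel_sets_of T" and T: "compact_space T"
  shows "carried_functional T (topspace T) (measure M (space M)) (\<lambda>g. LINT x|M. g x)"
proof -
  interpret finite_measure M by (rule M(1))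
  have integrable: "integrable M g" if g: "continuous_map T euclidean g" for g :: "'a \<Rightarrow> complex"
  proof -
    have "compact (g ` topspace T)"
      using image_compactin[OF _ g, of "topspace T"] T by (simp add: compact_space_def)
    then obtain B where "\<And>x. x \<in> topspace T \<Longrightarrow> norm (g x) \<le> B"
      using compact_imp_bounded bounded_iff by (metis imageI)
    then show ?thesis
      using M(2) by (intro integrable_const_bound[of _ B] borel_measurable_continuous_map[OF M(2,3) g]) auto
  qed
  show ?thesis
    unfolding carried_functional_def
  proof (intro conjI allI impI)
    fix g :: "'a \<Rightarrow> complex" and B :: real
    assume g: "continuous_map T euclidean g" and B: "0 \<le> B" "\<forall>x\<in>topspace T. norm (g x) \<le> B"
    have "(LINT x|M. norm (g x)) \<le> (LINT x|M. B)"
      using B M(2) integrable[OF g] by (intro integral_mono) auto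
    then have "(LINT x|M. norm (g x)) \<le> measure M (space M) * B" by simp
    then show "norm (LINT x|M. g x) \<le> measure M (space M) * B"
      by (rule order_trans[OF integral_norm_bound])
  qed (use T integrable in \<open>auto simp: compact_space_def\<close>)
qed

lemma Mor_bij:
  fixes k :: "'a::topological_group_add \<Rightarrow> 'a"
  shows "k \<in> carrier Mor \<Longrightarrow> bij k"
  unfolding Mor_def bij_def
  using homeomorphic_imp_injective_map homeomorphic_imp_surjective_map by fastforce

lemma compact_group_inverse:
  assumes "compact_group (Mor\<lparr>carrier := K\<rparr>) T" "k \<in> K"
  shows "inv\<^bsub>Mor\<lparr>carrier := K\<rparr>\<^esub> k = finv k"
proof -
  interpret group "Mor\<lparr>carrier := K\<rparr>" using assms by (simp add: compact_group_def)
  show ?thesis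
    using l_inv[of k] r_inv[of k] assms(2)
    by (intro inv_unique_comp[symmetric]) (simp_all add: Mor_def)
qed

text \<open>
  The measure is invariant under left translates of sets, so it equals its image under left
  translation.
\<close>

lemma haar_integral_left_invariant:
  fixes K :: "('a::topological_group_add \<Rightarrow> 'a) set" and g :: "('a \<Rightarrow> 'a) \<Rightarrow> complex"
  assumes G: "compact_group (Mor\<lparr>carrier := K\<rparr>) T" and sub: "K \<subseteq> carrier Mor"
    and haar: "normalized_haar_measure (Mor\<lparr>carrier := K\<rparr>) T dk"
    and k: "k \<in> K" and g: "continuous_map T euclidean g"
  shows "(LINT h|dk. g (k \<circ> h)) = (LINT h|dk. g h)"
proof -
  interpret group "Mor\<lparr>carrier := K\<rparr>" using G by (simp add: compact_group_def)
  have dk: "space dk = topspace T" "sets dk = borel_sets_of T" and top: "topspace T = K"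
    using haar G by (simp_all add: normalized_haar_measure_def compact_group_def)
  have mult: "continuous_map (prod_topology T T) T (case_prod (\<circ>))"
    using G by (simp add: compact_group_def Mor_def)
  have trans: "continuous_map T T (\<lambda>h. k \<circ> h)"
    using continuous_map_section[OF mult, of k] k top by simp
  have meas: "(\<lambda>h. k \<circ> h) \<in> measurable dk dk"
  proof (rule measurable_sigma_sets[OF dk(2)[unfolded borel_sets_of_def]])
    show "{U. openin T U} \<subseteq> Pow (topspace T)" using openin_subset by auto
    show "(\<lambda>h. k \<circ> h) \<in> space dk \<rightarrow> topspace T"
      using continuous_map_image_subset_topspace[OF trans] dk by auto
    fix U assume "U \<in> {U. openin T U}"
    then have "openin T {h \<in> topspace T. k \<circ> h \<in> U}"
      using openin_continuous_map_preimage[OF trans] by simp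
    moreover have "{h \<in> topspace T. k \<circ> h \<in> U} = (\<lambda>h. k \<circ> h) -` U \<inter> space dk" using dk by auto
    ultimately show "(\<lambda>h. k \<circ> h) -` U \<inter> space dk \<in> sets dk"
      unfolding dk(2) borel_sets_of_def by (intro sigma_sets.Basic) simp
  qed
  have "distr dk dk (\<lambda>h. k \<circ> h) = dk"
  proof (rule measure_eqI)
    fix A assume "A \<in> sets (distr dk dk (\<lambda>h. k \<circ> h))"
    then have A: "A \<in> sets dk" by simp
    then have AK: "A \<subseteq> K" using sets.sets_into_space dk top by blast
    have bk: "bij k" using k sub by (intro Mor_bij) auto
    have fk: "finv k \<in> K" using inv_closed[of k] k compact_group_inverse[OF G k] by simp
    have closed: "u \<circ> v \<in> K" if "u \<in> K" "v \<in> K" for u v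
      using m_closed[of u v] that by (simp add: Mor_def)
    have "(\<lambda>h. k \<circ> h) -` A \<inter> space dk = (\<lambda>h. finv k \<circ> h) ` A"
    proof (intro equalityI subsetI)
      fix h assume h: "h \<in> (\<lambda>h. k \<circ> h) -` A \<inter> space dk"
      have "h = finv k \<circ> (k \<circ> h)" using bk by (simp add: fun_eq_iff bij_is_inj)
      then show "h \<in> (\<lambda>h. finv k \<circ> h) ` A" using h by blast
    next
      fix h assume "h \<in> (\<lambda>h. finv k \<circ> h) ` A"
      then obtain h' where h': "h' \<in> A" "h = finv k \<circ> h'" by blast
      have "k \<circ> h = h'" using bk h' by (simp add: fun_eq_iff bij_is_surj surj_f_inv_f)
      then show "h \<in> (\<lambda>h. k \<circ> h) -` A \<inter> space dk"
        using h' AK closed fk dk top by auto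
    qed
    also have "\<dots> = finv k <#\<^bsub>Mor\<lparr>carrier := K\<rparr>\<^esub> A"
      by (auto simp: l_coset_def Mor_def)
    finally have "emeasure (distr dk dk (\<lambda>h. k \<circ> h)) A = emeasure dk (finv k <#\<^bsub>Mor\<lparr>carrier := K\<rparr>\<^esub> A)"
      using A meas by (simp add: emeasure_distr)
    also have "\<dots> = emeasure dk A"
      using haar fk A unfolding normalized_haar_measure_def by simp
    finally show "emeasure (distr dk dk (\<lambda>h. k \<circ> h)) A = emeasure dk A" .
  qed simp
  then show ?thesis
    using integral_distr[OF meas borel_measurable_continuous_map[OF dk g]] by simp
qed

lemma complex_integral_carried_functional:
  fixes \<mu> :: "'a::t2_space set \<Rightarrow> complex"
  assumes "complex_measure \<mu>" "compact (measure_support \<mu>)"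
  shows "carried_functional euclidean (measure_support \<mu>) (measure_norm \<mu>) (complex_integral \<mu>)"
  unfolding carried_functional_def
  using assms complex_integral_add[OF assms] complex_integral_mult[OF assms] complex_integral_bound[OF assms]
  by (auto simp: measure_norm_def)

lemma invariant_averages_of_measures:
  fixes K :: "('a::{topological_group_add, t2_space} \<Rightarrow> 'a) set"
  assumes K: "subgroup K Mor" and G: "compact_group (Mor\<lparr>carrier := K\<rparr>) T"
    and act: "continuous_map (prod_topology T euclidean) euclidean (\<lambda>(k, x). k x)"
    and haar: "normalized_haar_measure (Mor\<lparr>carrier := K\<rparr>) T dk"
    and \<mu>: "complex_measure \<mu>" "compact (measure_support \<mu>)" "invariant_under K \<mu>"
  shows "invariant_averages K T (\<lambda>g. LINT k|dk. g k) (complex_integral \<mu>) (measure_support \<mu>) (measure_norm \<mu>)"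
proof
  have sub: "K \<subseteq> carrier Mor" using K by (rule subgroup.subset)
  show top: "topspace T = K" using G by (simp add: compact_group_def)
  show "bij k" if "k \<in> K" for k using Mor_bij sub that by blast
  show "(\<forall>x y. k (x + y) = k x + k y) \<or> (\<forall>x y. k (x + y) = k y + k x)" if "k \<in> K" for k
    using sub that by (auto simp: Mor_def)
  show "continuous_map (prod_topology T T) T (\<lambda>(g, h). g \<circ> h)"
    using G by (simp add: compact_group_def Mor_def)
  show "continuous_map T T finv"
  proof (rule continuous_map_eq)
    show "continuous_map T T (\<lambda>h. inv\<^bsub>Mor\<lparr>carrier := K\<rparr>\<^esub> h)" using G by (simp add: compact_group_def)
  qed (simp add: top compact_group_inverse[OF G])
  show "continuous_map (prod_topology T euclidean) euclidean (\<lambda>(k, x). k x)" by (rule act)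
  show "carried_functional euclidean (measure_support \<mu>) (measure_norm \<mu>) (complex_integral \<mu>)"
    by (rule complex_integral_carried_functional[OF \<mu>(1,2)])
  have dk: "space dk = topspace T" "sets dk = borel_sets_of T" "emeasure dk (space dk) = 1"
    using haar by (simp_all add: normalized_haar_measure_def)
  then have fin: "finite_measure dk" and one: "measure dk (space dk) = 1"
    by (auto intro: finite_measureI simp: measure_def)
  show "carried_functional T K 1 (\<lambda>g. LINT k|dk. g k)"
    using integral_carried_functional[OF fin dk(1,2)] G one top by (simp add: compact_group_def)
  show "(LINT k|dk. 1) = (1 :: complex)" using one by simp
  show "complex_integral \<mu> (\<lambda>t. u (k t)) = complex_integral \<mu> u" if "k \<in> K" "continuous_on UNIV u" for k u
    using \<mu>(3) that unfolding invariant_under_def by blast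
  show "(LINT h|dk. g (k \<circ> h)) = (LINT h|dk. g h)" if "k \<in> K" "continuous_map T euclidean g"
    for k and g :: "('a \<Rightarrow> 'a) \<Rightarrow> complex"
    by (rule haar_integral_left_invariant[OF G sub haar that])
qed

section \<open>The superstability theorem\<close>

theorem corollary2p3:
  fixes K :: "('a::{topological_group_add, t2_space} \<Rightarrow> 'a) set"
    and T :: "('a \<Rightarrow> 'a) topology"
    and dk :: "('a \<Rightarrow> 'a) measure"
    and \<mu> :: "'a set \<Rightarrow> complex"
    and \<delta> :: real
    and f :: "'a \<Rightarrow> complex"
  assumes "locally_compact_space (euclidean :: 'a topology)"
    and "subgroup K Mor"
    and "compact_group (Mor\<lparr>carrier := K\<rparr>) T"
    and "continuous_map (prod_topology T euclidean) euclidean (\<lambda>(k, x). k x)"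
    and "normalized_haar_measure (Mor\<lparr>carrier := K\<rparr>) T dk"
    and "complex_measure \<mu>"
    and "compact (measure_support \<mu>)"
    and "invariant_under K \<mu>"
    and "\<delta> > 0"
    and "continuous_on UNIV f"
    and "\<And>x y. cmod (complex_integral \<mu> (\<lambda>t. LINT k|dk. f (x + t + k y)) - f x * f y) \<le> \<delta>"
  shows "(\<forall>x. cmod (f x) \<le> (measure_norm \<mu> + sqrt ((measure_norm \<mu>)\<^sup>2 + 4 * \<delta>)) / 2) \<or>
         (\<forall>x y. complex_integral \<mu> (\<lambda>t. LINT k|dk. f (x + t + k y)) = f x * f y)"
proof -
  interpret invariant_averages K T "\<lambda>g. LINT k|dk. g k" "complex_integral \<mu>" "measure_support \<mu>" "measure_norm \<mu>"
    by (rule invariant_averages_of_measures[OF assms(2-8)])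
  interpret product_formula_defect K T "\<lambda>g. LINT k|dk. g k" "complex_integral \<mu>" "measure_support \<mu>"
      "measure_norm \<mu>" f \<delta>
    by unfold_locales (rule assms)+
  show ?thesis
  proof (cases "bounded (range f)")
    case True
    then show ?thesis using bounded_case by blast
  next
    case False
    then show ?thesis using product_formula by blast
  qed
qed

end
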